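(* Consider the asymmetric log-GARCH$(p,q)$ model with innovations $(\eta_t)$ and the associated random matrices $\boldsymbol{C}_t$ and $\boldsymbol{A}_t$ defined in the context, and let $r=\max\{p,q\}$. Let $m$ be a positive integer. Assume that $\gamma(\mathbf{C})<0$ and that $E|\log\eta_0^2|^m<\infty$. Let $(\epsilon_t)$, with volatility $(\sigma_t^2)$, be the strictly stationary solution of the model. (i) If $m=1$ or $r=1$, then $\rho(\boldsymbol{A}^{(m)})<1$ implies $E|\log\epsilon_t^2|^m<\infty$ and $E|\log\sigma_t^2|^m<\infty$. (ii) If $\rho(\boldsymbol{C}^{(m)})<1$, then $E|\log\epsilon_t^2|^m<\infty$ and $E|\log\sigma_t^2|^m<\infty$.
   Context: **Model.** The asymmetric log-GARCH$(p,q)$ model is, for $t\in\mathbb{Z}$, $$\epsilon_t=\sigma_t\eta_t,\qquad \log\sigma_t^2=\omega+\sum_{i=1}^q\left(\alpha_{i+}1_{\{\epsilon_{t-i}>0\}}+\alpha_{i-}1_{\{\epsilon_{t-i}<0\}}\right)\log\epsilon_{t-i}^2+\sum_{j=1}^p\beta_j\log\sigma_{t-j}^2,$$ where $\sigma_t>0$, the coefficients $\omega,\alpha_{i+},\alpha_{i-},\beta_j$ are real (no sign constraints), and $(\eta_t)_{t\in\mathbb{Z}}$ is a given iid sequence of real random variables with $E\eta_0=0$, $E\eta_0^2=1$. Convention: $\log 0=-\infty$, so that finiteness of a moment of $|\log\eta_0^2|$ entails $P(\eta_0=0)=0$. Write $\boldsymbol{\alpha}_+=(\alpha_{1+},\dots,\alpha_{q+})$,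 $\boldsymbol{\alpha}_-=(\alpha_{1-},\dots,\alpha_{q-})$, $\boldsymbol{\beta}=(\beta_1,\dots,\beta_p)$ (row vectors). **Matrices $\boldsymbol{C}_t$.** $\boldsymbol{I}_k$ is the $k\times k$ identity, $\mathbf{0}$ denotes zero vectors/matrices of the indicated size. $\boldsymbol{C}_t$ is the $(2q+p)\times(2q+p)$ matrix $$\boldsymbol{C}_t=\begin{pmatrix}1_{\{\eta_t>0\}}\boldsymbol{\alpha}_+&1_{\{\eta_t>0\}}\boldsymbol{\alpha}_-&1_{\{\eta_t>0\}}\boldsymbol{\beta}\\ (\boldsymbol{I}_{q-1}\ \mathbf{0}_{q-1})&\mathbf{0}_{(q-1)\times q}&\mathbf{0}_{(q-1)\times p}\\ 1_{\{\eta_t<0\}}\boldsymbol{\alpha}_+&1_{\{\eta_t<0\}}\boldsymbol{\alpha}_-&1_{\{\eta_t<0\}}\boldsymbol{\beta}\\ \mathbf{0}_{(q-1)\times q}&(\boldsymbol{I}_{q-1}\ \mathbf{0}_{q-1})&\mathbf{0}_{(q-1)\times p}\\ \boldsymbol{\alpha}_+&\boldsymbol{\alpha}_-&\boldsymbol{\beta}\\ \mathbf{0}_{(p-1)\times q}&\mathbf{0}_{(p-1)\times q}&(\boldsymbol{I}_{p-1}\ \mathbf{0}_{p-1})\end{pmatrix}$$ (with obvious changes, i.e. empty blocks dropped, when $p\le1$ or $q\le1$). $\gamma(\mathbf{C})=\lim_{t\to\infty}\frac1tE\log\|\boldsymbol{C}_t\cdots\boldsymbol{C}_1\|=\inf_{t\ge1}\frac1tE\log\|\boldsymbol{C}_t\cdots\boldsymbol{C}_1\|$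 is the top Lyapunov exponent of $\mathbf{C}=(\boldsymbol{C}_t)$ (for any multiplicative matrix norm). **Matrices $\boldsymbol{A}_t$.** With $\mu_i(\eta_t)=\alpha_{i+}1_{\{\eta_t>0\}}+\alpha_{i-}1_{\{\eta_t<0\}}+\beta_i$ for $1\le i\le r$, where $\alpha_{i+}=\alpha_{i-}=0$ for $i>q$ and $\beta_i=0$ for $i>p$, $\boldsymbol{A}_t$ is the $r\times r$ companion matrix $$\boldsymbol{A}_t=\begin{pmatrix}\mu_1(\eta_{t-1})\ \cdots\ \mu_{r-1}(\eta_{t-r+1})&\mu_r(\eta_{t-r})\\ \boldsymbol{I}_{r-1}&\mathbf{0}_{r-1}\end{pmatrix}.$$ **Notation.** $\rho(\cdot)$ is the spectral radius; $\mathrm{Abs}(\boldsymbol{M})$ is the matrix of absolute values of the entries of $\boldsymbol{M}$; $\boldsymbol{M}^{\otimes m}$ is the $m$-fold Kronecker power; for an identically distributed sequence $(\boldsymbol{M}_t)$ of random matrices, $\boldsymbol{M}^{(m)}=E[\{\mathrm{Abs}(\boldsymbol{M}_1)\}^{\otimes m}]$. **Stationary solution.** When $\gamma(\mathbf{C})<0$ and $E\log^+|\log\eta_0^2|<\infty$, the model has a unique strictly stationary solution $(\epsilon_t,\sigma_t)_{t\in\mathbb{Z}}$, which is nonanticipative and ergodic; this is the solution referred to. *)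

theory Defs
  imports "HOL-Probability.Probability" "Jordan_Normal_Form.Spectral_Radius"
begin

text \<open>The convention is \<open>log 0 = -\<infinity>\<close>, whereas \<open>ln 0 = 0\<close> on type \<open>real\<close>.\<close>

definition elog :: "real \<Rightarrow> ereal" where
  "elog x = (if x \<le> 0 then -\<infinity> else ereal (ln x))"

text \<open>\<open>E |log X|^m\<close>, possibly infinite. For \<open>m > 0\<close>, finiteness entails \<open>X > 0\<close> almost surely.\<close>

definition abs_log_moment :: "'s measure \<Rightarrow> nat \<Rightarrow> ('s \<Rightarrow> real) \<Rightarrow> ennreal" where
  "abs_log_moment M m X = (\<integral>\<^sup>+w. e2ennreal (\<bar>elog (X w)\<bar> ^ m) \<partial>M)"

text \<open>Quasi-expectation \<open>E X = E X\<^sup>+ - E X\<^sup>-\<close>; note that \<^const>\<open>e2ennreal\<close> sends negative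
  values to \<open>0\<close>.\<close>

definition ereal_expectation :: "'s measure \<Rightarrow> ('s \<Rightarrow> ereal) \<Rightarrow> ereal" where
  "ereal_expectation M X =
     enn2ereal (\<integral>\<^sup>+w. e2ennreal (X w) \<partial>M) - enn2ereal (\<integral>\<^sup>+w. e2ennreal (- X w) \<partial>M)"

definition strictly_stationary :: "'s measure \<Rightarrow> (int \<Rightarrow> 's \<Rightarrow> 'b::topological_space) \<Rightarrow> bool" where
  "strictly_stationary M X \<longleftrightarrow>
     (\<forall>t. X t \<in> measurable M borel) \<and>
     (\<forall>J h. finite J \<longrightarrow>
        distr M (Pi\<^sub>M J (\<lambda>_. borel)) (\<lambda>w. \<lambda>t\<in>J. X (t + h) w) =
        distr M (Pi\<^sub>M J (\<lambda>_. borel)) (\<lambda>w. \<lambda>t\<in>J. X t w))"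

definition log_garch_innovations :: "'s measure \<Rightarrow> (int \<Rightarrow> 's \<Rightarrow> real) \<Rightarrow> bool" where
  "log_garch_innovations M \<eta> \<longleftrightarrow>
     prob_space.indep_vars M (\<lambda>_. borel) \<eta> UNIV \<and>
     (\<forall>t. distr M borel (\<eta> t) = distr M borel (\<eta> 0)) \<and>
     has_bochner_integral M (\<eta> 0) 0 \<and>
     has_bochner_integral M (\<lambda>w. (\<eta> 0 w)\<^sup>2) 1"

text \<open>The coefficient sequences \<open>ap\<close>, \<open>am\<close> (for \<open>\<alpha>\<^sub>+\<close>, \<open>\<alpha>\<^sub>-\<close>) and \<open>\<beta>\<close> are indexed from \<open>1\<close>; only
  \<open>ap i\<close>, \<open>am i\<close> with \<open>1 \<le> i \<le> q\<close> and \<open>\<beta> j\<close> with \<open>1 \<le> j \<le> p\<close> matter.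
  In the recursion both indicators vanish when \<open>\<epsilon> (t - i)\<close> is \<open>0\<close>, so the value of \<open>ln 0\<close> is
  irrelevant (the product is \<open>0\<close>, as with \<open>0 \<cdot> (-\<infinity>) = 0\<close>).\<close>

definition log_garch_solution ::
  "'s measure \<Rightarrow> nat \<Rightarrow> nat \<Rightarrow> real \<Rightarrow> (nat \<Rightarrow> real) \<Rightarrow> (nat \<Rightarrow> real) \<Rightarrow> (nat \<Rightarrow> real) \<Rightarrow>
   (int \<Rightarrow> 's \<Rightarrow> real) \<Rightarrow> (int \<Rightarrow> 's \<Rightarrow> real) \<Rightarrow> (int \<Rightarrow> 's \<Rightarrow> real) \<Rightarrow> bool" where
  "log_garch_solution M p q \<omega> ap am \<beta> \<eta> \<epsilon> \<sigma> \<longleftrightarrow>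
     (\<forall>t. \<epsilon> t \<in> borel_measurable M \<and> \<sigma> t \<in> borel_measurable M \<and>
       (AE w in M. \<sigma> t w > 0 \<and>
          \<epsilon> t w = \<sigma> t w * \<eta> t w \<and>
          ln ((\<sigma> t w)\<^sup>2) = \<omega>
            + (\<Sum>i=1..q. (ap i * of_bool (\<epsilon> (t - int i) w > 0) + am i * of_bool (\<epsilon> (t - int i) w < 0))
                         * ln ((\<epsilon> (t - int i) w)\<^sup>2))
            + (\<Sum>j=1..p. \<beta> j * ln ((\<sigma> (t - int j) w)\<^sup>2))))"

text \<open>\<open>C_mat p q ap am \<beta> x\<close> is \<open>C\<^sub>t\<close> for \<open>\<eta>\<^sub>t = x\<close>. With \<open>0\<close>-based indices, row \<open>0\<close>, row \<open>q\<close> and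
  row \<open>2q\<close> are the multiples of \<open>(\<alpha>\<^sub>+, \<alpha>\<^sub>-, \<beta>)\<close> by \<open>1\<^bsub>x>0\<^esub>\<close>, \<open>1\<^bsub>x<0\<^esub>\<close> and \<open>1\<close>; in each of the other rows
  the blocks \<open>(I 0)\<close> put a single \<open>1\<close> just left of the diagonal.
  Row \<open>2q\<close> is tested first, so that for \<open>q = 0\<close> only the \<open>\<beta>\<close>-block remains; for \<open>p = 0\<close> there is
  no row \<open>2q\<close>.\<close>

definition C_coeff :: "nat \<Rightarrow> (nat \<Rightarrow> real) \<Rightarrow> (nat \<Rightarrow> real) \<Rightarrow> (nat \<Rightarrow> real) \<Rightarrow> nat \<Rightarrow> real" where
  "C_coeff q ap am \<beta> j =
     (if j < q then ap (j + 1) else if j < 2 * q then am (j - q + 1) else \<beta> (j - 2 * q + 1))"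

definition C_mat ::
  "nat \<Rightarrow> nat \<Rightarrow> (nat \<Rightarrow> real) \<Rightarrow> (nat \<Rightarrow> real) \<Rightarrow> (nat \<Rightarrow> real) \<Rightarrow> real \<Rightarrow> real mat" where
  "C_mat p q ap am \<beta> x = Matrix.mat (2 * q + p) (2 * q + p) (\<lambda>(i, j).
     if i = 2 * q then C_coeff q ap am \<beta> j
     else if i = 0 then of_bool (x > 0) * C_coeff q ap am \<beta> j
     else if i = q then of_bool (x < 0) * C_coeff q ap am \<beta> j
     else of_bool (i = j + 1))"

definition mu_coeff ::
  "nat \<Rightarrow> nat \<Rightarrow> (nat \<Rightarrow> real) \<Rightarrow> (nat \<Rightarrow> real) \<Rightarrow> (nat \<Rightarrow> real) \<Rightarrow> nat \<Rightarrow> real \<Rightarrow> real" where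
  "mu_coeff p q ap am \<beta> i x =
     (if i \<le> q then ap i * of_bool (x > 0) + am i * of_bool (x < 0) else 0)
     + (if i \<le> p then \<beta> i else 0)"

text \<open>\<open>A_mat p q ap am \<beta> e t\<close> is \<open>A\<^sub>t\<close> for the innovation path \<open>e\<close>.\<close>

definition A_mat ::
  "nat \<Rightarrow> nat \<Rightarrow> (nat \<Rightarrow> real) \<Rightarrow> (nat \<Rightarrow> real) \<Rightarrow> (nat \<Rightarrow> real) \<Rightarrow> (int \<Rightarrow> real) \<Rightarrow> int \<Rightarrow> real mat" where
  "A_mat p q ap am \<beta> e t = Matrix.mat (max p q) (max p q) (\<lambda>(i, j).
     if i = 0 then mu_coeff p q ap am \<beta> (j + 1) (e (t - int (j + 1)))
     else of_bool (i = j + 1))"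

text \<open>The entrywise sum norm, which is submultiplicative. The exponent does not depend on the
  choice of a submultiplicative norm.\<close>

definition mat_norm :: "real mat \<Rightarrow> real" where
  "mat_norm A = (\<Sum>i<dim_row A. \<Sum>j<dim_col A. \<bar>A $$ (i, j)\<bar>)"

text \<open>\<open>mat_prod_upto d X t = X\<^sub>t \<cdots> X\<^sub>1\<close>\<close>

primrec mat_prod_upto :: "nat \<Rightarrow> (int \<Rightarrow> real mat) \<Rightarrow> nat \<Rightarrow> real mat" where
  "mat_prod_upto d X 0 = 1\<^sub>m d"
| "mat_prod_upto d X (Suc t) = X (int (Suc t)) * mat_prod_upto d X t"

text \<open>The infimum is also the limit, by subadditivity. The value may be \<open>-\<infinity>\<close>, for instance if
  some product vanishes with positive probability.\<close>

definition top_lyapunov :: "'s measure \<Rightarrow> nat \<Rightarrow> (int \<Rightarrow> 's \<Rightarrow> real mat) \<Rightarrow> ereal" where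
  "top_lyapunov M d X =
     (INF t\<in>{1::nat..}.
        ereal_expectation M (\<lambda>w. elog (mat_norm (mat_prod_upto d (\<lambda>s. X s w) t))) / ereal (real t))"

definition kronecker :: "real mat \<Rightarrow> real mat \<Rightarrow> real mat" where
  "kronecker A B = Matrix.mat (dim_row A * dim_row B) (dim_col A * dim_col B) (\<lambda>(i, j).
     A $$ (i div dim_row B, j div dim_col B) * B $$ (i mod dim_row B, j mod dim_col B))"

primrec kronecker_power :: "real mat \<Rightarrow> nat \<Rightarrow> real mat" where
  "kronecker_power A 0 = 1\<^sub>m 1"
| "kronecker_power A (Suc m) = kronecker A (kronecker_power A m)"

text \<open>\<open>E[Abs(X)\<^sup>\<otimes>\<^sup>m]\<close>, entry by entry, for a \<open>d \<times> d\<close> random matrix \<open>X\<close>.\<close>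

definition abs_kronecker_moment :: "'s measure \<Rightarrow> nat \<Rightarrow> nat \<Rightarrow> ('s \<Rightarrow> real mat) \<Rightarrow> real mat" where
  "abs_kronecker_moment M d m X = Matrix.mat (d ^ m) (d ^ m) (\<lambda>(i, j).
     \<integral>w. kronecker_power (map_mat abs (X w)) m $$ (i, j) \<partial>M)"

definition real_spectral_radius :: "real mat \<Rightarrow> real" where
  "real_spectral_radius A = spectral_radius (map_mat complex_of_real A)"

end

theory Submission
  imports Defs
begin

text \<open>
  Both parts are instances of one statement on affine recursions \<open>X\<^sub>t = F(\<eta>\<^sub>t) X\<^bsub>t-1\<^esub> + g(\<eta>\<^sub>t)\<close> with tight
  \<open>(X\<^sub>t)\<close>. After \<open>n\<close> iterations \<open>X\<^sub>t\<close> is a sum of noise terms plus a remainder that is linear in \<open>X\<^bsub>t-n\<^esub>\<close>.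
  The \<open>m\<close>-th moments of the entries of \<open>Abs(F(\<eta>\<^sub>t)) \<cdots> Abs(F(\<eta>\<^bsub>t-n+1\<^esub>))\<close> are entries of the \<open>n\<close>-th power of
  \<open>E[Abs(F)\<^sup>\<otimes>\<^sup>m]\<close>, so they decay geometrically. Hence the noise part is bounded in \<open>L\<^sup>m\<close> uniformly in \<open>n\<close>,
  while by tightness the remainder tends to \<open>0\<close> in probability, and \<open>X\<^sub>t\<close> has a finite \<open>m\<close>-th moment.
  Tightness comes from stationarity, and no independence between \<open>X\<^bsub>t-n\<^esub>\<close> and the products is used.

  For the matrices \<open>A\<close> with \<open>m = 1\<close>, the entries of \<open>A\<^sub>t\<close> involve different innovations. Another choice of
  the state vector replaces \<open>A\<^sub>t\<close> by the transpose of a companion matrix in \<open>\<eta>\<^sub>t\<close> alone, which has the same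
  expected absolute value up to transposition, hence the same spectral radius.
\<close>

section \<open>Spectral radius and Kronecker powers\<close>

lemma smult_pow_mat:
  fixes A :: "'a :: comm_semiring_1 mat"
  assumes A: "A \<in> carrier_mat n n"
  shows "(c \<cdot>\<^sub>m A) ^\<^sub>m k = c ^ k \<cdot>\<^sub>m A ^\<^sub>m k"
proof (induction k)
  case 0
  show ?case using A by (intro eq_matI) auto
next
  case (Suc k)
  have P: "A ^\<^sub>m k \<in> carrier_mat n n" using A by (rule pow_carrier_mat)
  have twice: "a \<cdot>\<^sub>m (b \<cdot>\<^sub>m X) = (b * a) \<cdot>\<^sub>m X" for a b :: 'a and X
    by (rule eq_matI) (simp_all add: ac_simps)
  show ?case
    unfolding pow_mat.simps Suc mult_smult_assoc_mat[OF P smult_carrier_mat[OF A]]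
      mult_smult_distrib[OF P A] twice by simp
qed

text \<open>Dividing \<open>A\<close> by some \<open>s\<close> strictly between its spectral radius
  and 1 leaves a matrix of spectral radius below 1. The powers of that matrix are uniformly bounded,
  and undoing the scaling produces the factor \<open>s ^ k\<close>.\<close>

lemma pow_mat_entry_geometric_bound:
  assumes A: "A \<in> carrier_mat n n" and n: "n > 0" and sr: "real_spectral_radius A < 1"
  obtains c s where "0 < s" "s < 1" "0 \<le> c"
    "\<And>k i j. i < n \<Longrightarrow> j < n \<Longrightarrow> \<bar>(A ^\<^sub>m k) $$ (i, j)\<bar> \<le> c * s ^ k"
proof -
  let ?B = "map_mat complex_of_real A"
  have B: "?B \<in> carrier_mat n n" using A by simp
  \<comment> \<open>The midpoint between the spectral radius and 1; the maximum with 0 makes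
    \<open>s\<close> visibly positive, as the division by \<open>s\<close> requires.\<close>
  define s where "s = (max 0 (real_spectral_radius A) + 1) / 2"
  have s: "0 < s" "s < 1" "real_spectral_radius A < s"
    using sr by (auto simp: s_def field_simps max_def)
  let ?D = "(1 / complex_of_real s) \<cdot>\<^sub>m ?B"
  have D: "?D \<in> carrier_mat n n" using B by simp
  have "spectral_radius ?D \<in> norm ` spectrum ?D"
    by (rule spectral_radius_mem_max(1)[OF D n])
  then obtain k where k: "eigenvalue ?D k" "spectral_radius ?D = norm k"
    by (auto simp: spectrum_def)
  then obtain v where v: "v \<in> carrier_vec n" "v \<noteq> 0\<^sub>v n" "?D *\<^sub>v v = k \<cdot>\<^sub>v v"
    using A by (auto simp: eigenvalue_def eigenvector_def)
  \<comment> \<open>An eigenvalue \<open>k\<close> of the rescaled matrix yields the eigenvalue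
    \<open>s * k\<close> of the original one, so \<open>s * norm k\<close> is at most the spectral
    radius, which is below \<open>s\<close>.\<close>
  have "?B *\<^sub>v v = (complex_of_real s * k) \<cdot>\<^sub>v v"
  proof -
    have "?B *\<^sub>v v = complex_of_real s \<cdot>\<^sub>v (?D *\<^sub>v v)"
      using s v(1) B by (intro eq_vecI) (auto simp: scalar_prod_def sum_distrib_left)
    also have "\<dots> = (complex_of_real s * k) \<cdot>\<^sub>v v"
      by (simp add: v(3) smult_smult_assoc)
    finally show ?thesis .
  qed
  then have "eigenvalue ?B (complex_of_real s * k)"
    using v A by (auto simp: eigenvalue_def eigenvector_def)
  then have "norm (complex_of_real s * k) \<le> real_spectral_radius A"
    unfolding real_spectral_radius_def
    by (intro spectral_radius_mem_max(2)[OF B n]) (auto simp: spectrum_def)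
  then have "s * norm k \<le> real_spectral_radius A" using s by (simp add: norm_mult)
  then have "s * norm k < s * 1" using s by linarith
  then have "norm k < 1" using s by (simp only: mult_less_cancel_left_pos)
  then have "spectral_radius ?D < 1" using s k by simp
  from spectral_radius_jnf_norm_bound_less_1_upper_triangular[OF D this]
  obtain c where c: "\<And>k. norm_bound (?D ^\<^sub>m k) c" by blast
  have B_pow: "?B ^\<^sub>m k = map_mat complex_of_real (A ^\<^sub>m k)" for k
    by (rule of_real_hom.mat_hom_pow[OF A, symmetric])
  have "\<bar>(A ^\<^sub>m k) $$ (i, j)\<bar> \<le> max c 0 * s ^ k" if "i < n" "j < n" for i j k
  proof -
    let ?a = "(A ^\<^sub>m k) $$ (i, j)"
    have ij: "i < dim_row (?B ^\<^sub>m k)" "j < dim_col (?B ^\<^sub>m k)"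
        "i < dim_row (A ^\<^sub>m k)" "j < dim_col (A ^\<^sub>m k)"
        "i < dim_row (?D ^\<^sub>m k)" "j < dim_col (?D ^\<^sub>m k)"
      using that by (simp_all only: carrier_matD[OF pow_carrier_mat[OF A]]
          carrier_matD[OF pow_carrier_mat[OF B]] carrier_matD[OF pow_carrier_mat[OF D]])
    have "(?D ^\<^sub>m k) $$ (i, j) = (1 / complex_of_real s) ^ k * complex_of_real ?a"
      by (simp only: smult_pow_mat[OF B] B_pow index_smult_mat(1) index_map_mat ij(3,4))
    then have "norm ((1 / complex_of_real s) ^ k * complex_of_real ?a) \<le> c"
      using c[of k] ij(5,6) unfolding norm_bound_def by metis
    then have "\<bar>?a\<bar> \<le> c * s ^ k"
      using s by (simp add: norm_mult norm_power norm_divide field_simps)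
    also have "\<dots> \<le> max c 0 * s ^ k" using s by (intro mult_right_mono) auto
    finally show ?thesis .
  qed
  then show ?thesis using s by (intro that[of s "max c 0"]) auto
qed

text \<open>Transposed matrices share the characteristic polynomial, hence the spectrum. This
  permits the state vector whose recursion uses transposed companion matrices.\<close>

lemma real_spectral_radius_transpose:
  assumes A: "A \<in> carrier_mat n n"
  shows "real_spectral_radius (transpose_mat A) = real_spectral_radius A"
proof -
  let ?B = "map_mat complex_of_real A"
  have B: "?B \<in> carrier_mat n n" using A by simp
  have T: "map_mat complex_of_real (transpose_mat A) = transpose_mat ?B"
    by (intro eq_matI) auto
  have "spectrum (transpose_mat ?B) = spectrum ?B"
    using spectrum_root_char_poly[OF B] spectrum_root_char_poly[of "transpose_mat ?B" n]
      char_poly_transpose_mat[OF B] B by simp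
  then show ?thesis by (simp add: real_spectral_radius_def spectral_radius_def T)
qed

section \<open>Kronecker products and their powers\<close>

lemma kronecker_dim [simp]:
  "dim_row (kronecker A B) = dim_row A * dim_row B" "dim_col (kronecker A B) = dim_col A * dim_col B"
  by (simp_all add: kronecker_def)

lemma kronecker_power_carrier:
  assumes A: "A \<in> carrier_mat n k"
  shows "kronecker_power A m \<in> carrier_mat (n ^ m) (k ^ m)"
proof (induction m)
  case (Suc m)
  show ?case
    by (rule carrier_matI) (simp_all add: carrier_matD[OF A] carrier_matD[OF Suc])
qed simp

text \<open>Writing \<open>l = i * b + j\<close> is a bijection between flat Kronecker indices and
  pairs of indices.\<close>

lemma sum_div_mod:
  fixes f :: "nat \<Rightarrow> nat \<Rightarrow> 'a :: comm_monoid_add"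
  shows "(\<Sum>l<a * b. f (l div b) (l mod b)) = (\<Sum>i<a. \<Sum>j<b. f i j)"
proof -
  have "(\<Sum>l<a * b. f (l div b) (l mod b)) = (\<Sum>(i, j)\<in>{..<a} \<times> {..<b}. f i j)"
  proof (rule sum.reindex_bij_witness[where i = "\<lambda>(i, j). i * b + j" and j = "\<lambda>l. (l div b, l mod b)"])
    fix l assume "l \<in> {..<a * b}"
    then show "(l div b, l mod b) \<in> {..<a} \<times> {..<b}"
      by (cases "b = 0") (auto simp: less_mult_imp_div_less)
  next
    fix x assume "x \<in> {..<a} \<times> {..<b}"
    then obtain i j where x: "x = (i, j)" "i < a" "j < b" by auto
    have "i * b + j < Suc i * b" using x by simp
    also have "\<dots> \<le> a * b" using x by (intro mult_right_mono) auto
    finally show "(case x of (i, j) \<Rightarrow> i * b + j) \<in> {..<a * b}" using x by simp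
  qed auto
  then show ?thesis by (simp add: sum.cartesian_product)
qed

text \<open>The mixed-product property: the flat summation index of the right-hand side splits into
  a pair by \<open>sum_div_mod\<close>, and the resulting double sum factors.\<close>

lemma kronecker_mult:
  assumes "dim_col A = dim_row C" "dim_col B = dim_row D"
  shows "kronecker (A * C) (B * D) = kronecker A B * kronecker C D"
proof (rule eq_matI)
  fix i j
  assume "i < dim_row (kronecker A B * kronecker C D)" "j < dim_col (kronecker A B * kronecker C D)"
  then have i: "i < dim_row A * dim_row B" and j: "j < dim_col C * dim_col D" by auto
  have pos: "dim_row B > 0" "dim_col D > 0" using i j by (auto intro: gr0I)
  have lt: "i div dim_row B < dim_row A" "i mod dim_row B < dim_row B"
    "j div dim_col D < dim_col C" "j mod dim_col D < dim_col D"
    using i j pos by (auto simp: less_mult_imp_div_less)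
  let ?i1 = "i div dim_row B" and ?i2 = "i mod dim_row B"
    and ?j1 = "j div dim_col D" and ?j2 = "j mod dim_col D"
  have "(kronecker A B * kronecker C D) $$ (i, j) =
      (\<Sum>l<dim_row C * dim_row D. A $$ (?i1, l div dim_row D) * B $$ (?i2, l mod dim_row D)
         * (C $$ (l div dim_row D, ?j1) * D $$ (l mod dim_row D, ?j2)))"
    using i j assms
    by (simp add: scalar_prod_def kronecker_def lessThan_atLeast0)
  also have "\<dots> = (\<Sum>a<dim_row C. \<Sum>b<dim_row D. A $$ (?i1, a) * B $$ (?i2, b)
         * (C $$ (a, ?j1) * D $$ (b, ?j2)))"
    by (rule sum_div_mod)
  also have "\<dots> = (\<Sum>a<dim_row C. A $$ (?i1, a) * C $$ (a, ?j1))
      * (\<Sum>b<dim_row D. B $$ (?i2, b) * D $$ (b, ?j2))"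
    by (simp add: sum_product ac_simps)
  also have "\<dots> = kronecker (A * C) (B * D) $$ (i, j)"
    using i j lt assms by (simp add: kronecker_def scalar_prod_def lessThan_atLeast0)
  finally show "kronecker (A * C) (B * D) $$ (i, j) = (kronecker A B * kronecker C D) $$ (i, j)" ..
qed auto

lemma kronecker_power_mult:
  assumes A: "A \<in> carrier_mat n k" and B: "B \<in> carrier_mat k l"
  shows "kronecker_power (A * B) m = kronecker_power A m * kronecker_power B m"
proof (induction m)
  case (Suc m)
  then show ?case
    using A B carrier_matD[OF kronecker_power_carrier[OF A, of m]]
      carrier_matD[OF kronecker_power_carrier[OF B, of m]]
    by (simp add: kronecker_mult carrier_matD)
qed simp

lemma kronecker_power_one: "kronecker_power (1\<^sub>m d) m = 1\<^sub>m (d ^ m)"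
proof (induction m)
  case (Suc m)
  show ?case unfolding kronecker_power.simps Suc
  proof (rule eq_matI)
    fix i j assume "i < dim_row (1\<^sub>m (d ^ Suc m))" "j < dim_col (1\<^sub>m (d ^ Suc m))"
    then have ij: "i < d * d ^ m" "j < d * d ^ m" by auto
    have pos: "0 < d ^ m" using ij by (cases "d ^ m = 0") auto
    have "i = j \<longleftrightarrow> i div d ^ m = j div d ^ m \<and> i mod d ^ m = j mod d ^ m"
      by (metis div_mod_decomp)
    then show "kronecker (1\<^sub>m d) (1\<^sub>m (d ^ m)) $$ (i, j) = 1\<^sub>m (d ^ Suc m) $$ (i, j)"
      using ij pos by (auto simp: kronecker_def less_mult_imp_div_less)
  qed auto
qed simp

text \<open>The repeated index \<open>(i, \<dots>, i)\<close> of the \<open>m\<close>-fold Kronecker power.\<close>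

primrec repeat_index :: "nat \<Rightarrow> nat \<Rightarrow> nat \<Rightarrow> nat" where
  "repeat_index d i 0 = 0"
| "repeat_index d i (Suc m) = i * d ^ m + repeat_index d i m"

lemma repeat_index_less: "i < d \<Longrightarrow> repeat_index d i m < d ^ m"
proof (induction m)
  case (Suc m)
  have "i * d ^ m + repeat_index d i m < Suc i * d ^ m" using Suc by simp
  also have "\<dots> \<le> d * d ^ m" using Suc.prems by (intro mult_right_mono) auto
  finally show ?case by simp
qed simp

text \<open>The index \<open>(i, ..., i)\<close> against \<open>(j, ..., j)\<close> selects the same
  entry in each of the \<open>m\<close> factors. This turns \<open>m\<close>-th powers of entries
  into something linear in the Kronecker power.\<close>

lemma kronecker_power_repeat_index:
  assumes A: "A \<in> carrier_mat d d" and ij: "i < d" "j < d"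
  shows "kronecker_power A m $$ (repeat_index d i m, repeat_index d j m) = (A $$ (i, j)) ^ m"
proof (induction m)
  case (Suc m)
  have pos: "0 < d ^ m" using ij by simp
  have lt: "repeat_index d i m < d ^ m" "repeat_index d j m < d ^ m"
    "repeat_index d i (Suc m) < d * d ^ m" "repeat_index d j (Suc m) < d * d ^ m"
    using repeat_index_less[of i d "Suc m"] repeat_index_less[of j d "Suc m"]
      repeat_index_less[of i d m] repeat_index_less[of j d m] ij by auto
  then show ?case
    using A carrier_matD[OF kronecker_power_carrier[OF A, of m]] Suc pos
    by (simp add: kronecker_def)
qed simp

section \<open>Products of independent random matrices\<close>

text \<open>Jensen's inequality for \<open>x ^ m\<close> on the half-line, with weights
  \<open>w i / W\<close> at the points \<open>x i * W / w i\<close>, where \<open>W\<close> is the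
  sum of the \<open>w i\<close>. With geometric weights it takes the place of Minkowski's inequality
  for the noise series.\<close>

lemma sum_power_le_weighted:
  fixes x w :: "'a \<Rightarrow> real"
  assumes I: "finite I" and x: "\<And>i. i \<in> I \<Longrightarrow> 0 \<le> x i" and w: "\<And>i. i \<in> I \<Longrightarrow> 0 < w i" and m: "m > 0"
  shows "(\<Sum>i\<in>I. x i) ^ m \<le> (\<Sum>i\<in>I. w i) ^ (m - 1) * (\<Sum>i\<in>I. x i ^ m / w i ^ (m - 1))"
proof (cases "I = {}")
  case True
  then show ?thesis using m by (simp add: power_0_left)
next
  case False
  define W where "W = (\<Sum>i\<in>I. w i)"
  have W: "W > 0" unfolding W_def using I False w by (intro sum_pos)
  obtain k where k: "m = Suc k" using m by (cases m) auto
  have conv: "convex_on {0::real..} (\<lambda>x. x ^ m)"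
    by (cases "even m") (auto intro: convex_power_odd convex_on_subset[OF convex_power_even])
  have "(\<Sum>i\<in>I. (w i / W) *\<^sub>R (x i * W / w i)) ^ m \<le> (\<Sum>i\<in>I. (w i / W) * (x i * W / w i) ^ m)"
  proof (rule convex_on_sum[OF I False conv])
    show "(\<Sum>i\<in>I. w i / W) = 1" using W by (simp add: W_def flip: sum_divide_distrib)
    show "0 \<le> w i / W" "x i * W / w i \<in> {0..}" if "i \<in> I" for i
      using W w[OF that] x[OF that] by auto
  qed
  also have "(\<Sum>i\<in>I. (w i / W) *\<^sub>R (x i * W / w i)) = (\<Sum>i\<in>I. x i)"
    using W by (intro sum.cong) (auto dest!: w)
  also have "(\<Sum>i\<in>I. (w i / W) * (x i * W / w i) ^ m) = (\<Sum>i\<in>I. W ^ (m - 1) * (x i ^ m / w i ^ (m - 1)))"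
  proof (rule sum.cong)
    fix i assume "i \<in> I"
    then have "w i > 0" by (rule w)
    then show "(w i / W) * (x i * W / w i) ^ m = W ^ (m - 1) * (x i ^ m / w i ^ (m - 1))"
      using W by (simp add: k power_mult_distrib power_divide field_simps)
  qed simp
  finally show ?thesis by (simp add: W_def sum_distrib_left)
qed

text \<open>Truncate \<open>\<bar>h\<bar>\<close> at a level \<open>L\<close>. Where
  \<open>V n \<le> 1\<close> it is at most \<open>R n + 1\<close>; the exceptional set costs at most
  \<open>L ^ m\<close> times its probability. Since \<open>n\<close> is chosen after
  \<open>L\<close>, the bound on the truncated moments is free of \<open>L\<close>, and Fatou's
  lemma removes the truncation.\<close>

lemma (in prob_space) integrable_power_of_approx:
  fixes h :: "'a \<Rightarrow> real" and R V :: "nat \<Rightarrow> 'a \<Rightarrow> real"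
  assumes h [measurable]: "h \<in> borel_measurable M"
    and V [measurable]: "\<And>n. V n \<in> borel_measurable M"
    and R: "\<And>n. integrable M (\<lambda>x. R n x ^ m)" "\<And>n x. 0 \<le> R n x" "\<And>n. (\<integral>x. R n x ^ m \<partial>M) \<le> K"
    and le: "\<And>n. AE x in M. \<bar>h x\<bar> \<le> R n x + V n x"
    and small: "\<And>\<delta>. 0 < \<delta> \<Longrightarrow> \<exists>n. prob {x \<in> space M. V n x > 1} \<le> \<delta>"
  shows "integrable M (\<lambda>x. \<bar>h x\<bar> ^ m)"
proof -
  have two: "(a + 1) ^ m \<le> 2 ^ m * (a ^ m + 1)" if "0 \<le> a" for a :: real
  proof -
    have "(a + 1) ^ m \<le> (2 * max a 1) ^ m" using that by (intro power_mono) auto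
    also have "\<dots> \<le> 2 ^ m * (a ^ m + 1)"
      using that by (auto simp: power_mult_distrib max_def)
    finally show ?thesis .
  qed
  have int: "integrable M (\<lambda>x. (min \<bar>h x\<bar> (real L)) ^ m)" for L
    by (rule integrable_const_bound[where B = "real L ^ m"]) (auto intro!: power_mono)
  have bound: "(\<integral>x. (min \<bar>h x\<bar> (real L)) ^ m \<partial>M) \<le> 2 ^ m * (K + 1)" for L
  proof (rule field_le_epsilon)
    fix e :: real assume e: "0 < e"
    \<comment> \<open>Chosen so that \<open>L ^ m * \<delta> \<le> e\<close>; the added 1 keeps the
      denominator positive when \<open>L = 0\<close>.\<close>
    define \<delta> where "\<delta> = e / (real L ^ m + 1)"
    have \<delta>: "0 < \<delta>" unfolding \<delta>_def using e by (intro divide_pos_pos) (auto intro: add_nonneg_pos)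
    from small[OF this] obtain n where n: "prob {x \<in> space M. V n x > 1} \<le> \<delta>" by blast
    let ?A = "{x \<in> space M. V n x > 1}"
    have "(\<integral>x. (min \<bar>h x\<bar> (real L)) ^ m \<partial>M) \<le>
        (\<integral>x. 2 ^ m * (R n x ^ m + 1) + real L ^ m * indicator ?A x \<partial>M)"
    proof (rule integral_mono_AE[OF int])
      show "integrable M (\<lambda>x. 2 ^ m * (R n x ^ m + 1) + real L ^ m * indicator ?A x)"
        using R(1) by (intro Bochner_Integration.integrable_add integrable_mult_right) (auto simp: emeasure_eq_measure)
      show "AE x in M. (min \<bar>h x\<bar> (real L)) ^ m \<le> 2 ^ m * (R n x ^ m + 1) + real L ^ m * indicator ?A x"
        using le[of n] AE_space
      proof eventually_elim
        case (elim x)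
        show ?case
        proof (cases "x \<in> ?A")
          case True
          have "(min \<bar>h x\<bar> (real L)) ^ m \<le> real L ^ m" by (intro power_mono) auto
          moreover have "0 \<le> 2 ^ m * (R n x ^ m + 1)" using R(2)[of n x] by simp
          ultimately show ?thesis using True by simp
        next
          case False
          then have "(min \<bar>h x\<bar> (real L)) ^ m \<le> (R n x + 1) ^ m"
            using elim by (intro power_mono) auto
          also have "\<dots> \<le> 2 ^ m * (R n x ^ m + 1)" using R(2) by (rule two)
          finally show ?thesis using False by simp
        qed
      qed
    qed
    also have "\<dots> = 2 ^ m * ((\<integral>x. R n x ^ m \<partial>M) + 1) + real L ^ m * prob ?A"
      using R(1)[of n] by (simp add: prob_space emeasure_eq_measure)
    also have "\<dots> \<le> 2 ^ m * (K + 1) + real L ^ m * \<delta>"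
      using R(3)[of n] n by (intro add_mono mult_left_mono) auto
    also have "real L ^ m * \<delta> \<le> e"
    proof -
      have "0 < real L ^ m + 1" by (simp add: add_nonneg_pos)
      then show ?thesis using e by (simp add: \<delta>_def pos_divide_le_eq)
    qed
    finally show "(\<integral>x. (min \<bar>h x\<bar> (real L)) ^ m \<partial>M) \<le> 2 ^ m * (K + 1) + e" by simp
  qed
  have lim: "(\<lambda>L. ennreal ((min \<bar>h x\<bar> (real L)) ^ m)) \<longlonglongrightarrow> ennreal (\<bar>h x\<bar> ^ m)" for x
  proof (rule tendsto_eventually)
    obtain N where N: "\<bar>h x\<bar> \<le> real N" using real_arch_simple by blast
    show "\<forall>\<^sub>F L in sequentially. ennreal ((min \<bar>h x\<bar> (real L)) ^ m) = ennreal (\<bar>h x\<bar> ^ m)"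
      using eventually_ge_at_top[of N]
    proof eventually_elim
      case (elim L)
      then have "\<bar>h x\<bar> \<le> real L" using N by linarith
      then show ?case by simp
    qed
  qed
  \<comment> \<open>Fatou's lemma; pointwise the truncated powers are eventually constant in
    \<open>L\<close>.\<close>
  have "(\<integral>\<^sup>+x. ennreal (\<bar>h x\<bar> ^ m) \<partial>M) = (\<integral>\<^sup>+x. liminf (\<lambda>L. ennreal ((min \<bar>h x\<bar> (real L)) ^ m)) \<partial>M)"
    by (intro nn_integral_cong lim_imp_Liminf[symmetric] lim) simp
  also have "\<dots> \<le> liminf (\<lambda>L. \<integral>\<^sup>+x. ennreal ((min \<bar>h x\<bar> (real L)) ^ m) \<partial>M)"
    by (rule nn_integral_liminf) simp
  also have "\<dots> \<le> ennreal (2 ^ m * (K + 1))"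
    using bound by (intro Liminf_le) (auto simp: nn_integral_eq_integral[OF int] intro!: always_eventually ennreal_leI)
  also have "\<dots> < \<infinity>" by simp
  finally show ?thesis
    by (intro integrableI_bounded) (auto simp: power_abs)
qed

text \<open>This is G(e(t)) G(e(t-1)) ... G(e(t-n+1)). Each new factor enters on the right and
  carries the oldest time, so it can be split off as independent of the product built so
  far.\<close>

primrec back_prod :: "nat \<Rightarrow> (real \<Rightarrow> real mat) \<Rightarrow> (int \<Rightarrow> real) \<Rightarrow> int \<Rightarrow> nat \<Rightarrow> real mat" where
  "back_prod d G e t 0 = 1\<^sub>m d"
| "back_prod d G e t (Suc n) = back_prod d G e t n * G (e (t - int n))"

lemma back_prod_carrier:
  assumes "\<And>x. G x \<in> carrier_mat d d"
  shows "back_prod d G e t n \<in> carrier_mat d d"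
  using assms by (induction n) (auto intro: mult_carrier_mat)

lemma back_prod_Suc_entry:
  assumes G: "\<And>x. G x \<in> carrier_mat d d" and ij: "i < d" "j < d"
  shows "back_prod d G e t (Suc n) $$ (i, j) =
    (\<Sum>l<d. back_prod d G e t n $$ (i, l) * G (e (t - int n)) $$ (l, j))"
  using ij carrier_matD[OF G] carrier_matD[OF back_prod_carrier[OF G]]
  by (simp add: scalar_prod_def lessThan_atLeast0)

text \<open>Only the window from \<open>t - n + 1\<close> to \<open>t\<close> enters, so a path may
  be restricted to it before independence of disjoint blocks of innovations is applied.\<close>

lemma back_prod_cong:
  assumes "\<And>s. t - int n < s \<Longrightarrow> s \<le> t \<Longrightarrow> e s = e' s"
  shows "back_prod d G e t n = back_prod d G e' t n"
  using assms
proof (induction n)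
  case (Suc n)
  then have "back_prod d G e t n = back_prod d G e' t n" "e (t - int n) = e' (t - int n)" by auto
  then show ?case by simp
qed simp

lemma back_prod_measurable:
  assumes G: "\<And>x. G x \<in> carrier_mat d d"
    and G_meas: "\<And>i j. i < d \<Longrightarrow> j < d \<Longrightarrow> (\<lambda>x. G x $$ (i, j)) \<in> borel_measurable borel"
    and ij: "i < d" "j < d" and S: "{t - int n<..t} \<subseteq> S"
  shows "(\<lambda>e. back_prod d G e t n $$ (i, j)) \<in> borel_measurable (PiM S (\<lambda>_. borel))"
  using ij S
proof (induction n arbitrary: j)
  case (Suc n)
  have [measurable]: "(\<lambda>e. e (t - int n)) \<in> borel_measurable (PiM S (\<lambda>_. borel :: real measure))"
    using Suc.prems by (intro measurable_component_singleton) auto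
  show ?case
    unfolding back_prod_Suc_entry[OF G Suc.prems(1,2)]
  proof (rule borel_measurable_sum)
    fix l assume "l \<in> {..<d}"
    then have l: "l < d" by simp
    have [measurable]: "(\<lambda>e. back_prod d G e t n $$ (i, l)) \<in> borel_measurable (PiM S (\<lambda>_. borel))"
      using Suc.prems l by (intro Suc.IH) auto
    have [measurable]: "(\<lambda>x. G x $$ (l, j)) \<in> borel_measurable borel"
      by (rule G_meas[OF l Suc.prems(2)])
    show "(\<lambda>e. back_prod d G e t n $$ (i, l) * G (e (t - int n)) $$ (l, j)) \<in> borel_measurable (PiM S (\<lambda>_. borel))"
      by measurable
  qed
qed simp

text \<open>Multiplicativity of Kronecker powers, factor by factor: the moments of a product become
  means of a product of the same kind in dimension \<open>d ^ m\<close>.\<close>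

lemma back_prod_kronecker_power:
  assumes G: "\<And>x. G x \<in> carrier_mat d d"
  shows "back_prod (d ^ m) (\<lambda>x. kronecker_power (G x) m) e t n = kronecker_power (back_prod d G e t n) m"
proof (induction n)
  case (Suc n)
  then show ?case by (simp add: kronecker_power_mult[OF back_prod_carrier[OF G] G])
qed (simp add: kronecker_power_one)

context prob_space
begin

text \<open>The product is a function of the innovations at the times after \<open>t - n\<close> up
  to \<open>t\<close>, a set disjoint from \<open>{t - n}\<close>.\<close>

lemma indep_back_prod:
  fixes \<eta> :: "int \<Rightarrow> 'a \<Rightarrow> real"
  assumes ind: "indep_vars (\<lambda>_. borel) \<eta> UNIV"
    and G: "\<And>x. G x \<in> carrier_mat d d"
    and G_meas: "\<And>i j. i < d \<Longrightarrow> j < d \<Longrightarrow> (\<lambda>x. G x $$ (i, j)) \<in> borel_measurable borel"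
    and ij: "i < d" "j < d"
    and h: "h \<in> borel_measurable borel" and \<psi>: "\<psi> \<in> borel_measurable borel"
  shows "indep_var borel (\<lambda>w. h (back_prod d G (\<lambda>s. \<eta> s w) t n $$ (i, j)) :: real)
    borel (\<lambda>w. \<psi> (\<eta> (t - int n) w) :: real)"
proof -
  let ?S = "{t - int n<..t}" and ?u = "t - int n"
  have "indep_var (PiM ?S (\<lambda>_. borel)) (\<lambda>w. restrict (\<lambda>s. \<eta> s w) ?S)
      (PiM {?u} (\<lambda>_. borel)) (\<lambda>w. restrict (\<lambda>s. \<eta> s w) {?u})"
    by (intro indep_var_restrict[where M' = "\<lambda>_. borel" and I = UNIV, OF ind]) simp_all
  moreover have "(\<lambda>e. back_prod d G e t n $$ (i, j)) \<in> borel_measurable (PiM ?S (\<lambda>_. borel))"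
    using G G_meas ij order_refl by (rule back_prod_measurable)
  from this h have "(\<lambda>e. h (back_prod d G e t n $$ (i, j))) \<in> borel_measurable (PiM ?S (\<lambda>_. borel))"
    by (rule measurable_compose)
  moreover have "(\<lambda>e. e ?u) \<in> borel_measurable (PiM {?u} (\<lambda>_. borel))"
    by (rule measurable_component_singleton) simp
  from this \<psi> have "(\<lambda>e. \<psi> (e ?u)) \<in> borel_measurable (PiM {?u} (\<lambda>_. borel))"
    by (rule measurable_compose)
  ultimately have "indep_var borel ((\<lambda>e. h (back_prod d G e t n $$ (i, j))) \<circ> (\<lambda>w. restrict (\<lambda>s. \<eta> s w) ?S))
      borel ((\<lambda>e. \<psi> (e ?u)) \<circ> (\<lambda>w. restrict (\<lambda>s. \<eta> s w) {?u}))"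
    by (rule indep_var_compose)
  moreover have "back_prod d G (restrict (\<lambda>s. \<eta> s w) ?S) t n = back_prod d G (\<lambda>s. \<eta> s w) t n" for w
    by (rule back_prod_cong) auto
  ultimately show ?thesis by (simp only: comp_def restrict_apply singletonI if_True)
qed

text \<open>Induction on \<open>n\<close>: the oldest factor is independent of the others, so each
  expectation of a product splits, and the sum over the inner index is matrix multiplication by the
  mean.\<close>

lemma expectation_back_prod:
  fixes \<eta> :: "int \<Rightarrow> 'a \<Rightarrow> real"
  assumes ind: "indep_vars (\<lambda>_. borel) \<eta> UNIV"
    and ident: "\<And>t. distr M borel (\<eta> t) = distr M borel (\<eta> 0)"
    and G: "\<And>x. G x \<in> carrier_mat d d"
    and G_meas: "\<And>i j. i < d \<Longrightarrow> j < d \<Longrightarrow> (\<lambda>x. G x $$ (i, j)) \<in> borel_measurable borel"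
    and G_int: "\<And>i j. i < d \<Longrightarrow> j < d \<Longrightarrow> integrable M (\<lambda>w. G (\<eta> 0 w) $$ (i, j))"
    and ij: "i < d" "j < d"
  shows "integrable M (\<lambda>w. back_prod d G (\<lambda>s. \<eta> s w) t n $$ (i, j))"
    and "expectation (\<lambda>w. back_prod d G (\<lambda>s. \<eta> s w) t n $$ (i, j)) =
      (Matrix.mat d d (\<lambda>(i, j). expectation (\<lambda>w. G (\<eta> 0 w) $$ (i, j))) ^\<^sub>m n) $$ (i, j)"
proof -
  let ?E = "Matrix.mat d d (\<lambda>(i, j). expectation (\<lambda>w. G (\<eta> 0 w) $$ (i, j)))"
  have E: "?E \<in> carrier_mat d d" by simp
  have \<eta> [measurable]: "\<eta> t \<in> borel_measurable M" for t
    using ind by (auto simp: indep_vars_def)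
  have "integrable M (\<lambda>w. back_prod d G (\<lambda>s. \<eta> s w) t n $$ (i, j)) \<and>
    expectation (\<lambda>w. back_prod d G (\<lambda>s. \<eta> s w) t n $$ (i, j)) = (?E ^\<^sub>m n) $$ (i, j)"
    using ij(2)
  proof (induction n arbitrary: j)
    case 0
    then show ?case using ij by (simp add: prob_space)
  next
    case (Suc n)
    let ?u = "t - int n"
    note j = \<open>j < d\<close>
    \<comment> \<open>Both facts depend only on the law of the innovation, which is the same at time
      \<open>t - n\<close> as at time 0.\<close>
    have G_u: "integrable M (\<lambda>w. G (\<eta> ?u w) $$ (l, j))"
      "expectation (\<lambda>w. G (\<eta> ?u w) $$ (l, j)) = expectation (\<lambda>w. G (\<eta> 0 w) $$ (l, j))" if "l < d" for l
    proof -
      have "integrable (distr M borel (\<eta> ?u)) (\<lambda>x. G x $$ (l, j))"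
        unfolding ident[of ?u] using G_int[OF that j] G_meas[OF that j]
        by (simp add: integrable_distr_eq)
      then show "integrable M (\<lambda>w. G (\<eta> ?u w) $$ (l, j))"
        using G_meas[OF that j] by (simp add: integrable_distr_eq)
      have "integral\<^sup>L (distr M borel (\<eta> ?u)) (\<lambda>x. G x $$ (l, j)) =
          integral\<^sup>L (distr M borel (\<eta> 0)) (\<lambda>x. G x $$ (l, j))"
        by (simp only: ident[of ?u])
      then show "expectation (\<lambda>w. G (\<eta> ?u w) $$ (l, j)) = expectation (\<lambda>w. G (\<eta> 0 w) $$ (l, j))"
        using G_meas[OF that j] by (simp add: integral_distr)
    qed
    have indep: "indep_var borel (\<lambda>w. back_prod d G (\<lambda>s. \<eta> s w) t n $$ (i, l))
        borel (\<lambda>w. G (\<eta> ?u w) $$ (l, j))" if "l < d" for l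
      using indep_back_prod[OF ind G G_meas ij(1) that, of "\<lambda>x. x" "\<lambda>x. G x $$ (l, j)" t n]
        G_meas[OF that j] by simp
    have int: "integrable M (\<lambda>w. back_prod d G (\<lambda>s. \<eta> s w) t n $$ (i, l) * G (\<eta> ?u w) $$ (l, j))"
      if "l < d" for l
      by (rule indep_var_integrable[OF indep[OF that] conjunct1[OF Suc.IH[OF that]] G_u(1)[OF that]])
    have "expectation (\<lambda>w. back_prod d G (\<lambda>s. \<eta> s w) t (Suc n) $$ (i, j)) =
        (\<Sum>l<d. expectation (\<lambda>w. back_prod d G (\<lambda>s. \<eta> s w) t n $$ (i, l) * G (\<eta> ?u w) $$ (l, j)))"
      unfolding back_prod_Suc_entry[OF G ij(1) j] using int by (intro Bochner_Integration.integral_sum) auto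
    also have "\<dots> = (\<Sum>l<d. (?E ^\<^sub>m n) $$ (i, l) * ?E $$ (l, j))"
    proof (rule sum.cong)
      fix l assume "l \<in> {..<d}"
      then have l: "l < d" by simp
      show "expectation (\<lambda>w. back_prod d G (\<lambda>s. \<eta> s w) t n $$ (i, l) * G (\<eta> ?u w) $$ (l, j)) =
          (?E ^\<^sub>m n) $$ (i, l) * ?E $$ (l, j)"
        unfolding indep_var_lebesgue_integral[OF indep[OF l] conjunct1[OF Suc.IH[OF l]] G_u(1)[OF l]]
          G_u(2)[OF l] conjunct2[OF Suc.IH[OF l]] using l j by simp
    qed simp
    also have "\<dots> = (?E ^\<^sub>m Suc n) $$ (i, j)"
      using ij(1) j carrier_matD[OF pow_carrier_mat[OF E, of n]]
      by (simp add: scalar_prod_def lessThan_atLeast0)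
    finally have "expectation (\<lambda>w. back_prod d G (\<lambda>s. \<eta> s w) t (Suc n) $$ (i, j)) =
        (?E ^\<^sub>m Suc n) $$ (i, j)" .
    moreover have "integrable M (\<lambda>w. back_prod d G (\<lambda>s. \<eta> s w) t (Suc n) $$ (i, j))"
      unfolding back_prod_Suc_entry[OF G ij(1) j] using int by (intro Bochner_Integration.integrable_sum) simp
    ultimately show ?case by blast
  qed
  then show "integrable M (\<lambda>w. back_prod d G (\<lambda>s. \<eta> s w) t n $$ (i, j))"
    and "expectation (\<lambda>w. back_prod d G (\<lambda>s. \<eta> s w) t n $$ (i, j)) = (?E ^\<^sub>m n) $$ (i, j)"
    by blast+
qed

end

section \<open>Moments of random affine recursions\<close>

lemma kronecker_power_entry_measurable:
  assumes G: "\<And>x. G x \<in> carrier_mat d d"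
    and G_meas: "\<And>i j. i < d \<Longrightarrow> j < d \<Longrightarrow> (\<lambda>x. G x $$ (i, j)) \<in> borel_measurable N"
    and ij: "i < d ^ m" "j < d ^ m"
  shows "(\<lambda>x. kronecker_power (G x) m $$ (i, j)) \<in> borel_measurable N"
  using ij
proof (induction m arbitrary: i j)
  case (Suc m)
  have pos: "0 < d ^ m" using Suc.prems by (cases "d ^ m = 0") auto
  have lt: "i div d ^ m < d" "j div d ^ m < d" "i mod d ^ m < d ^ m" "j mod d ^ m < d ^ m"
    using Suc.prems pos by (auto simp: less_mult_imp_div_less)
  have "kronecker_power (G x) (Suc m) $$ (i, j) =
      G x $$ (i div d ^ m, j div d ^ m) * kronecker_power (G x) m $$ (i mod d ^ m, j mod d ^ m)" for x
    using Suc.prems carrier_matD[OF G[of x]] carrier_matD[OF kronecker_power_carrier[OF G, of x m]]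
    by (simp add: kronecker_def)
  then show ?case
    using G_meas[OF lt(1,2)] Suc.IH[OF lt(3,4)] by simp
qed simp

lemma kronecker_power_entry_bounded:
  fixes A :: "real mat"
  assumes A: "A \<in> carrier_mat d d"
    and bound: "\<And>i j. i < d \<Longrightarrow> j < d \<Longrightarrow> \<bar>A $$ (i, j)\<bar> \<le> K" and K: "0 \<le> K"
    and ij: "i < d ^ m" "j < d ^ m"
  shows "\<bar>kronecker_power A m $$ (i, j)\<bar> \<le> K ^ m"
  using ij
proof (induction m arbitrary: i j)
  case (Suc m)
  have pos: "0 < d ^ m" using Suc.prems by (cases "d ^ m = 0") auto
  have lt: "i div d ^ m < d" "j div d ^ m < d" "i mod d ^ m < d ^ m" "j mod d ^ m < d ^ m"
    using Suc.prems pos by (auto simp: less_mult_imp_div_less)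
  have "kronecker_power A (Suc m) $$ (i, j) =
      A $$ (i div d ^ m, j div d ^ m) * kronecker_power A m $$ (i mod d ^ m, j mod d ^ m)"
    using Suc.prems carrier_matD[OF A] carrier_matD[OF kronecker_power_carrier[OF A, of m]]
    by (simp add: kronecker_def)
  then show ?case
    using mult_mono[OF bound[OF lt(1,2)] Suc.IH[OF lt(3,4)]] K by (simp add: abs_mult)
qed simp

text \<open>The bound \<open>B\<close> in \<open>X_tight\<close> is uniform in \<open>t\<close>, so
  it survives going back \<open>n\<close> steps. Boundedness of \<open>F\<close> makes Kronecker
  powers of every order integrable, while the noise has just the \<open>m\<close>-th moment.\<close>

locale random_affine_recursion = prob_space M for M :: "'s measure" +
  fixes \<eta> :: "int \<Rightarrow> 's \<Rightarrow> real" and d m :: nat and F :: "real \<Rightarrow> real mat"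
    and g :: "real \<Rightarrow> nat \<Rightarrow> real" and X :: "int \<Rightarrow> 's \<Rightarrow> nat \<Rightarrow> real"
  assumes indep: "indep_vars (\<lambda>_. borel) \<eta> UNIV"
    and ident: "distr M borel (\<eta> t) = distr M borel (\<eta> 0)"
    and m_pos: "m > 0"
    and F_carrier: "F x \<in> carrier_mat d d"
    and F_measurable: "\<lbrakk>i < d; j < d\<rbrakk> \<Longrightarrow> (\<lambda>x. F x $$ (i, j)) \<in> borel_measurable borel"
    and F_bounded: "\<exists>K. \<forall>x i j. i < d \<longrightarrow> j < d \<longrightarrow> \<bar>F x $$ (i, j)\<bar> \<le> K"
    and g_measurable: "i < d \<Longrightarrow> (\<lambda>x. g x i) \<in> borel_measurable borel"
    and g_moment: "i < d \<Longrightarrow> integrable M (\<lambda>w. \<bar>g (\<eta> 0 w) i\<bar> ^ m)"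
    and X_measurable: "i < d \<Longrightarrow> (\<lambda>w. X t w i) \<in> borel_measurable M"
    and recursion: "AE w in M. \<forall>i<d. X t w i = (\<Sum>j<d. F (\<eta> t w) $$ (i, j) * X (t - 1) w j) + g (\<eta> t w) i"
    and X_tight: "\<lbrakk>i < d; 0 < \<delta>\<rbrakk> \<Longrightarrow> \<exists>B. \<forall>t. prob {w \<in> space M. \<bar>X t w i\<bar> > B} \<le> \<delta>"
    and contraction: "real_spectral_radius (abs_kronecker_moment M d m (\<lambda>w. F (\<eta> 0 w))) < 1"
begin

text \<open>After \<open>n\<close> iterations this is the factor in front of
  \<open>\<bar>X (t - n) w j\<bar>\<close> in the bound for \<open>\<bar>X t w i\<bar>\<close>, and
  also in front of the noise at time \<open>t - n\<close>.\<close>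

definition weight :: "nat \<Rightarrow> int \<Rightarrow> nat \<Rightarrow> nat \<Rightarrow> 's \<Rightarrow> real" where
  "weight n t i j w = back_prod d (\<lambda>x. map_mat abs (F x)) (\<lambda>s. \<eta> s w) t n $$ (i, j)"

lemma eta_measurable [measurable]: "\<eta> t \<in> borel_measurable M"
  using indep by (auto simp: indep_vars_def)

lemma abs_F_carrier: "map_mat abs (F x) \<in> carrier_mat d d"
  using F_carrier by simp

lemma abs_F_entry: "\<lbrakk>i < d; j < d\<rbrakk> \<Longrightarrow> map_mat abs (F x) $$ (i, j) = \<bar>F x $$ (i, j)\<bar>"
  using carrier_matD[OF F_carrier] by simp

lemma abs_F_measurable:
  assumes "i < d" "j < d"
  shows "(\<lambda>x. map_mat abs (F x) $$ (i, j)) \<in> borel_measurable borel"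
  unfolding abs_F_entry[OF assms] using F_measurable[OF assms] by simp

lemma weight_0: "\<lbrakk>i < d; j < d\<rbrakk> \<Longrightarrow> weight 0 t i j w = of_bool (i = j)"
  by (simp add: weight_def)

lemma weight_Suc:
  assumes "i < d" "j < d"
  shows "weight (Suc n) t i j w = (\<Sum>l<d. weight n t i l w * \<bar>F (\<eta> (t - int n) w) $$ (l, j)\<bar>)"
  unfolding weight_def back_prod_Suc_entry[OF abs_F_carrier assms]
  using assms by (intro sum.cong) (simp_all add: abs_F_entry)

lemma weight_nonneg: "\<lbrakk>i < d; j < d\<rbrakk> \<Longrightarrow> 0 \<le> weight n t i j w"
proof (induction n arbitrary: j)
  case (Suc n)
  then show ?case by (auto simp: weight_Suc intro!: sum_nonneg)
qed (simp add: weight_0)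

lemma weight_measurable: "\<lbrakk>i < d; j < d\<rbrakk> \<Longrightarrow> weight n t i j \<in> borel_measurable M"
proof (induction n arbitrary: j)
  case 0
  then have "weight 0 t i j = (\<lambda>_. of_bool (i = j))" by (simp add: weight_0 fun_eq_iff)
  then show ?case by simp
next
  case (Suc n)
  have "weight (Suc n) t i j = (\<lambda>w. \<Sum>l<d. weight n t i l w * \<bar>F (\<eta> (t - int n) w) $$ (l, j)\<bar>)"
    using Suc.prems by (simp add: weight_Suc fun_eq_iff)
  moreover have "(\<lambda>w. F (\<eta> (t - int n) w) $$ (l, j)) \<in> borel_measurable M" if "l < d" for l
    by (rule measurable_compose[OF eta_measurable F_measurable[OF that Suc.prems(2)]])
  ultimately show ?case using Suc by simp
qed

text \<open>The \<open>m\<close>-th power of an entry of a matrix is an entry of the \<open>m\<close>-fold Kronecker power, which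
  is multiplicative; so independence turns the moment into an entry of a power of the mean matrix.\<close>

lemma weight_moment:
  obtains c s where "0 < s" "s < 1" "0 \<le> c"
    "\<And>n t i j. i < d \<Longrightarrow> j < d \<Longrightarrow> integrable M (\<lambda>w. weight n t i j w ^ m)"
    "\<And>n t i j. i < d \<Longrightarrow> j < d \<Longrightarrow> expectation (\<lambda>w. weight n t i j w ^ m) \<le> c * s ^ n"
proof (cases "d = 0")
  \<comment> \<open>In dimension 0 there are no entries and any constants serve; the bound on matrix
    powers needs a positive dimension.\<close>
  case True
  then show ?thesis by (intro that[of "1/2" 0]) auto
next
  case False
  let ?K = "\<lambda>x. kronecker_power (map_mat abs (F x)) m"
  let ?E = "abs_kronecker_moment M d m (\<lambda>w. F (\<eta> 0 w))"
  have dm: "0 < d ^ m" using False by simp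
  have E: "?E \<in> carrier_mat (d ^ m) (d ^ m)" by (simp add: abs_kronecker_moment_def)
  have K: "?K x \<in> carrier_mat (d ^ m) (d ^ m)" for x
    by (rule kronecker_power_carrier[OF abs_F_carrier])
  have K_meas: "(\<lambda>x. ?K x $$ (i, j)) \<in> borel_measurable borel" if "i < d ^ m" "j < d ^ m" for i j
    using abs_F_carrier abs_F_measurable that by (rule kronecker_power_entry_measurable)
  obtain B where B: "\<And>x i j. i < d \<Longrightarrow> j < d \<Longrightarrow> \<bar>F x $$ (i, j)\<bar> \<le> B"
    using F_bounded by blast
  have K_int: "integrable M (\<lambda>w. ?K (\<eta> 0 w) $$ (i, j))" if "i < d ^ m" "j < d ^ m" for i j
  proof (rule integrable_const_bound[where B = "B ^ m"])
    have B0: "0 \<le> B" using B[of 0 0 0] False by linarith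
    have "\<bar>?K x $$ (i, j)\<bar> \<le> B ^ m" for x
      using abs_F_carrier _ B0 that by (rule kronecker_power_entry_bounded) (simp add: abs_F_entry B)
    then show "AE w in M. norm (?K (\<eta> 0 w) $$ (i, j)) \<le> B ^ m" by simp
    show "(\<lambda>w. ?K (\<eta> 0 w) $$ (i, j)) \<in> borel_measurable M"
      by (rule measurable_compose[OF eta_measurable K_meas[OF that]])
  qed
  obtain s c where cs: "0 < s" "s < 1" "0 \<le> c"
    "\<And>k i j. i < d ^ m \<Longrightarrow> j < d ^ m \<Longrightarrow> \<bar>(?E ^\<^sub>m k) $$ (i, j)\<bar> \<le> c * s ^ k"
    by (rule pow_mat_entry_geometric_bound[OF E dm contraction], rule that)
  have eq: "weight n t i j w ^ m =
      back_prod (d ^ m) ?K (\<lambda>s. \<eta> s w) t n $$ (repeat_index d i m, repeat_index d j m)"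
    if "i < d" "j < d" for n t i j w
    unfolding back_prod_kronecker_power[OF abs_F_carrier] weight_def
    by (rule kronecker_power_repeat_index[OF back_prod_carrier[OF abs_F_carrier] that, symmetric])
  show ?thesis
  proof (rule that[OF cs(1-3)])
    fix n t i j assume ij: "i < d" "j < d"
    let ?i = "repeat_index d i m" and ?j = "repeat_index d j m"
    note r = repeat_index_less[OF ij(1), of m] repeat_index_less[OF ij(2), of m]
    show "integrable M (\<lambda>w. weight n t i j w ^ m)"
      unfolding eq[OF ij] using indep ident K K_meas K_int r by (rule expectation_back_prod(1))
    have "expectation (\<lambda>w. back_prod (d ^ m) ?K (\<lambda>s. \<eta> s w) t n $$ (?i, ?j)) =
      (Matrix.mat (d ^ m) (d ^ m) (\<lambda>(i, j). expectation (\<lambda>w. ?K (\<eta> 0 w) $$ (i, j))) ^\<^sub>m n) $$ (?i, ?j)"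
      using indep ident K K_meas K_int r by (rule expectation_back_prod(2))
    then have "expectation (\<lambda>w. weight n t i j w ^ m) = (?E ^\<^sub>m n) $$ (?i, ?j)"
      unfolding eq[OF ij] abs_kronecker_moment_def .
    also have "\<dots> \<le> c * s ^ n" using cs(4)[OF r, of n] by linarith
    finally show "expectation (\<lambda>w. weight n t i j w ^ m) \<le> c * s ^ n" .
  qed
qed

text \<open>The weight involves only innovations later than \<open>t - n\<close>, so it is
  independent of the noise at time \<open>t - n\<close> and the \<open>m\<close>-th moments
  multiply.\<close>

lemma noise_moment:
  assumes ij: "i < d" "j < d" and int: "integrable M (\<lambda>w. weight n t i j w ^ m)"
  shows "integrable M (\<lambda>w. (weight n t i j w * \<bar>g (\<eta> (t - int n) w) j\<bar>) ^ m)"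
    and "expectation (\<lambda>w. (weight n t i j w * \<bar>g (\<eta> (t - int n) w) j\<bar>) ^ m) =
      expectation (\<lambda>w. weight n t i j w ^ m) * expectation (\<lambda>w. \<bar>g (\<eta> 0 w) j\<bar> ^ m)"
proof -
  let ?u = "t - int n" and ?\<psi> = "\<lambda>x. \<bar>g x j\<bar> ^ m"
  have \<psi>: "?\<psi> \<in> borel_measurable borel" using g_measurable[OF ij(2)] by simp
  have "integrable (distr M borel (\<eta> ?u)) ?\<psi>"
    unfolding ident[of ?u] using g_moment[OF ij(2)] \<psi> by (simp add: integrable_distr_eq)
  then have \<psi>_int: "integrable M (\<lambda>w. ?\<psi> (\<eta> ?u w))"
    using \<psi> by (simp add: integrable_distr_eq)
  have "integral\<^sup>L (distr M borel (\<eta> ?u)) ?\<psi> = integral\<^sup>L (distr M borel (\<eta> 0)) ?\<psi>"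
    by (simp only: ident[of ?u])
  then have \<psi>_eq: "expectation (\<lambda>w. ?\<psi> (\<eta> ?u w)) = expectation (\<lambda>w. ?\<psi> (\<eta> 0 w))"
    using \<psi> by (simp add: integral_distr)
  have "(\<lambda>x::real. x ^ m) \<in> borel_measurable borel" by simp
  from indep_back_prod[OF indep abs_F_carrier abs_F_measurable ij this \<psi>]
  have ind: "indep_var borel (\<lambda>w. weight n t i j w ^ m) borel (\<lambda>w. ?\<psi> (\<eta> ?u w))"
    by (simp add: weight_def)
  show "integrable M (\<lambda>w. (weight n t i j w * \<bar>g (\<eta> ?u w) j\<bar>) ^ m)"
    unfolding power_mult_distrib by (rule indep_var_integrable[OF ind int \<psi>_int])
  show "expectation (\<lambda>w. (weight n t i j w * \<bar>g (\<eta> ?u w) j\<bar>) ^ m) =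
      expectation (\<lambda>w. weight n t i j w ^ m) * expectation (\<lambda>w. \<bar>g (\<eta> 0 w) j\<bar> ^ m)"
    unfolding power_mult_distrib indep_var_lebesgue_integral[OF ind int \<psi>_int] \<psi>_eq ..
qed

text \<open>Induction on \<open>n\<close>: one more use of the recursion at time
  \<open>t - n\<close>, with the triangle inequality, splits the remainder into the noise at that
  time and the next remainder.\<close>

lemma iterated_recursion:
  "AE w in M. \<forall>t. \<forall>i<d. \<forall>n. \<bar>X t w i\<bar> \<le>
     (\<Sum>(k, j)\<in>{..<n} \<times> {..<d}. weight k t i j w * \<bar>g (\<eta> (t - int k) w) j\<bar>)
     + (\<Sum>j<d. weight n t i j w * \<bar>X (t - int n) w j\<bar>)"
proof -
  \<comment> \<open>Times are countable, so a single null set allows the recursion to be iterated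
    pathwise.\<close>
  have "AE w in M. \<forall>t. \<forall>i<d. X t w i = (\<Sum>j<d. F (\<eta> t w) $$ (i, j) * X (t - 1) w j) + g (\<eta> t w) i"
    using recursion by (simp add: AE_all_countable)
  then show ?thesis
  proof eventually_elim
    case (elim w)
    show ?case
    proof (intro allI impI)
      fix t i n assume i: "i < d"
      show "\<bar>X t w i\<bar> \<le> (\<Sum>(k, j)\<in>{..<n} \<times> {..<d}. weight k t i j w * \<bar>g (\<eta> (t - int k) w) j\<bar>)
        + (\<Sum>j<d. weight n t i j w * \<bar>X (t - int n) w j\<bar>)"
      proof (induction n)
        case 0
        have "(\<Sum>j<d. weight 0 t i j w * \<bar>X t w j\<bar>) = (\<Sum>j<d. if j = i then \<bar>X t w i\<bar> else 0)"
          using i by (intro sum.cong) (auto simp: weight_0)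
        then show ?case using i by simp
      next
        case (Suc n)
        let ?u = "t - int n" and ?W = "\<lambda>j. weight n t i j w"
        have u: "t - int (Suc n) = ?u - 1" by simp
        have step: "\<bar>X ?u w j\<bar> \<le> (\<Sum>l<d. \<bar>F (\<eta> ?u w) $$ (j, l)\<bar> * \<bar>X (?u - 1) w l\<bar>) + \<bar>g (\<eta> ?u w) j\<bar>"
          if "j < d" for j
        proof -
          have "\<bar>X ?u w j\<bar> \<le> \<bar>\<Sum>l<d. F (\<eta> ?u w) $$ (j, l) * X (?u - 1) w l\<bar> + \<bar>g (\<eta> ?u w) j\<bar>"
            unfolding elim[rule_format, OF that, of ?u] by (rule abs_triangle_ineq)
          also have "\<bar>\<Sum>l<d. F (\<eta> ?u w) $$ (j, l) * X (?u - 1) w l\<bar> \<le>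
              (\<Sum>l<d. \<bar>F (\<eta> ?u w) $$ (j, l)\<bar> * \<bar>X (?u - 1) w l\<bar>)"
            by (rule order_trans[OF sum_abs]) (simp add: abs_mult)
          finally show ?thesis by simp
        qed
        have "(\<Sum>j<d. ?W j * \<bar>X ?u w j\<bar>) \<le> (\<Sum>j<d. ?W j *
            ((\<Sum>l<d. \<bar>F (\<eta> ?u w) $$ (j, l)\<bar> * \<bar>X (?u - 1) w l\<bar>) + \<bar>g (\<eta> ?u w) j\<bar>))"
          using step i by (intro sum_mono mult_left_mono) (auto intro: weight_nonneg)
        also have "\<dots> = (\<Sum>j<d. ?W j * \<bar>g (\<eta> ?u w) j\<bar>)
            + (\<Sum>j<d. \<Sum>l<d. ?W j * \<bar>F (\<eta> ?u w) $$ (j, l)\<bar> * \<bar>X (?u - 1) w l\<bar>)"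
          by (simp add: distrib_left sum.distrib sum_distrib_left mult.assoc)
        \<comment> \<open>With the old coordinate \<open>j\<close> summed innermost, the coefficient
          of each \<open>\<bar>X (t - n - 1) w l\<bar>\<close> is the next weight.\<close>
        also have "(\<Sum>j<d. \<Sum>l<d. ?W j * \<bar>F (\<eta> ?u w) $$ (j, l)\<bar> * \<bar>X (?u - 1) w l\<bar>) =
            (\<Sum>l<d. \<Sum>j<d. ?W j * \<bar>F (\<eta> ?u w) $$ (j, l)\<bar> * \<bar>X (?u - 1) w l\<bar>)"
          by (rule sum.swap)
        also have "\<dots> = (\<Sum>l<d. weight (Suc n) t i l w * \<bar>X (?u - 1) w l\<bar>)"
          using i by (intro sum.cong) (auto simp: weight_Suc sum_distrib_right)
        finally show ?case
          using Suc unfolding u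
          by (simp add: sum.cartesian_product[symmetric])
      qed
    qed
  qed
qed

text \<open>Tightness bounds the old state by a constant outside a small event, whatever
  \<open>n\<close> is, and by Markov's inequality the weights tend to 0 in probability. A union
  bound combines the two without any joint law.\<close>

lemma remainder_small:
  assumes i: "i < d" and \<delta>: "0 < \<delta>"
  shows "\<exists>n. prob {w \<in> space M. (\<Sum>j<d. weight n t i j w * \<bar>X (t - int n) w j\<bar>) > 1} \<le> \<delta>"
proof -
  \<comment> \<open>Two exceptional events for each of the \<open>d\<close> coordinates share the
    budget \<open>\<delta>\<close>.\<close>
  define e where "e = \<delta> / (2 * real d)"
  have e: "0 < e" using i \<delta> by (simp add: e_def)
  have "\<forall>j\<in>{..<d}. \<exists>B. \<forall>t. prob {w \<in> space M. \<bar>X t w j\<bar> > B} \<le> e"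
    using X_tight e by auto
  then obtain B0 where B0: "\<And>j t. j < d \<Longrightarrow> prob {w \<in> space M. \<bar>X t w j\<bar> > B0 j} \<le> e"
    unfolding bchoice_iff by auto
  \<comment> \<open>One positive bound that dominates the bounds of all coordinates.\<close>
  define B where "B = 1 + (\<Sum>j<d. \<bar>B0 j\<bar>)"
  have B: "1 \<le> B" by (simp add: B_def sum_nonneg)
  have B_ge: "B0 j \<le> B" if "j < d" for j
    using member_le_sum[of j "{..<d}" "\<lambda>j. \<bar>B0 j\<bar>"] that by (simp add: B_def)
  have X_small: "prob {w \<in> space M. \<bar>X t w j\<bar> > B} \<le> e" if "j < d" for j t
  proof -
    have [measurable]: "(\<lambda>w. X t w j) \<in> borel_measurable M" by (rule X_measurable[OF that])
    have "prob {w \<in> space M. \<bar>X t w j\<bar> > B} \<le> prob {w \<in> space M. \<bar>X t w j\<bar> > B0 j}"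
      using B_ge[OF that] by (intro finite_measure_mono) auto
    then show ?thesis using B0[OF that, of t] by linarith
  qed
  obtain c s where cs: "0 < s" "s < 1" "0 \<le> c"
    "\<And>n t i j. i < d \<Longrightarrow> j < d \<Longrightarrow> integrable M (\<lambda>w. weight n t i j w ^ m)"
    "\<And>n t i j. i < d \<Longrightarrow> j < d \<Longrightarrow> expectation (\<lambda>w. weight n t i j w ^ m) \<le> c * s ^ n"
    by (rule weight_moment, rule that)
  \<comment> \<open>If all weights are at most \<open>a\<close> and all old coordinates at most
    \<open>B\<close>, the \<open>d\<close> terms sum to at most 1.\<close>
  define a where "a = 1 / (real d * B)"
  have a: "0 < a" using i B by (simp add: a_def)
  have "(\<lambda>n. c * s ^ n / a ^ m) \<longlonglongrightarrow> c * 0 / a ^ m"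
    using cs a by (intro tendsto_intros LIMSEQ_power_zero) auto
  then have "\<forall>\<^sub>F n in sequentially. c * s ^ n / a ^ m < e"
    using e by (intro order_tendstoD(2)) auto
  then obtain n where n: "c * s ^ n / a ^ m < e" unfolding eventually_sequentially by blast
  let ?u = "t - int n"
  let ?P = "\<lambda>j. {w \<in> space M. \<bar>X ?u w j\<bar> > B}" and ?Q = "\<lambda>j. {w \<in> space M. a ^ m \<le> weight n t i j w ^ m}"
  have meas: "(\<lambda>w. X ?u w j) \<in> borel_measurable M" "weight n t i j \<in> borel_measurable M" if "j < d" for j
    using X_measurable[OF that] weight_measurable[OF i that] by auto
  have sets: "?P j \<in> sets M" "?Q j \<in> sets M" if "j < d" for j
    using meas[OF that] by measurable
  have Q_small: "prob (?Q j) \<le> e" if "j < d" for j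
  proof -
    \<comment> \<open>Markov's inequality for the \<open>m\<close>-th power of the weight.\<close>
    have "prob (?Q j) \<le> expectation (\<lambda>w. weight n t i j w ^ m) / a ^ m"
      using cs(4)[OF i that] weight_nonneg[OF i that] a
      by (intro integral_Markov_inequality_measure[where A = "{}"]) auto
    also have "\<dots> \<le> c * s ^ n / a ^ m"
      using cs(5)[OF i that] a by (intro divide_right_mono) auto
    finally show ?thesis using n by simp
  qed
  have sub: "{w \<in> space M. (\<Sum>j<d. weight n t i j w * \<bar>X ?u w j\<bar>) > 1} \<subseteq> (\<Union>j<d. ?P j \<union> ?Q j)"
  proof (rule subsetI, rule ccontr)
    fix w assume w: "w \<in> {w \<in> space M. (\<Sum>j<d. weight n t i j w * \<bar>X ?u w j\<bar>) > 1}"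
      and "w \<notin> (\<Union>j<d. ?P j \<union> ?Q j)"
    then have small: "\<bar>X ?u w j\<bar> \<le> B" "weight n t i j w ^ m < a ^ m" if "j < d" for j
      using that by (auto simp: not_less not_le)
    have "(\<Sum>j<d. weight n t i j w * \<bar>X ?u w j\<bar>) \<le> (\<Sum>j<d. a * B)"
    proof (intro sum_mono mult_mono)
      fix j assume "j \<in> {..<d}"
      then have j: "j < d" by simp
      show "weight n t i j w \<le> a"
        using power_less_imp_less_base[OF small(2)[OF j]] a by simp
      show "\<bar>X ?u w j\<bar> \<le> B" by (rule small(1)[OF j])
    qed (use a in auto)
    also have "\<dots> = 1" using i B by (simp add: a_def)
    finally show False using w by simp
  qed
  have "prob {w \<in> space M. (\<Sum>j<d. weight n t i j w * \<bar>X ?u w j\<bar>) > 1} \<le> prob (\<Union>j<d. ?P j \<union> ?Q j)"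
    using sub sets by (intro finite_measure_mono sets.finite_UN) auto
  also have "\<dots> \<le> (\<Sum>j<d. prob (?P j \<union> ?Q j))"
    using sets by (intro finite_measure_subadditive_finite) auto
  also have "\<dots> \<le> (\<Sum>j<d. 2 * e)"
  proof (rule sum_mono)
    fix j assume "j \<in> {..<d}"
    then have j: "j < d" by simp
    show "prob (?P j \<union> ?Q j) \<le> 2 * e"
      using measure_Un_le[OF sets[OF j]] X_small[OF j, of ?u] Q_small[OF j] by linarith
  qed
  also have "\<dots> = \<delta>" using i by (simp add: e_def)
  finally show ?thesis by blast
qed

text \<open>\<open>integrable_power_of_approx\<close> is applied to the noise sum \<open>R\<close>
  and the remainder \<open>V\<close>. For a bound on the moments of \<open>R\<close> uniform in
  \<open>n\<close>, the noise term at lag \<open>k\<close> gets the weight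
  \<open>\<theta> ^ k\<close>: its \<open>m\<close>-th moment is at most a constant times
  \<open>(\<theta> ^ k) ^ m\<close>, and division by \<open>(\<theta> ^ k) ^ (m - 1)\<close> leaves
  a summable \<open>\<theta> ^ k\<close>.\<close>

theorem integrable_moment:
  assumes i: "i < d"
  shows "integrable M (\<lambda>w. \<bar>X t w i\<bar> ^ m)"
proof -
  obtain c s where cs: "0 < s" "s < 1" "0 \<le> c"
    "\<And>n t i j. i < d \<Longrightarrow> j < d \<Longrightarrow> integrable M (\<lambda>w. weight n t i j w ^ m)"
    "\<And>n t i j. i < d \<Longrightarrow> j < d \<Longrightarrow> expectation (\<lambda>w. weight n t i j w ^ m) \<le> c * s ^ n"
    by (rule weight_moment, rule that)
  \<comment> \<open>The decay rate of the weights in the \<open>m\<close>-norm, as \<open>s\<close>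
    is the rate of their \<open>m\<close>-th moments.\<close>
  define \<theta> where "\<theta> = root m s"
  have \<theta>: "0 < \<theta>" "\<theta> < 1" "\<theta> ^ m = s"
    using cs m_pos by (auto simp: \<theta>_def)
  define \<Gamma> where "\<Gamma> = (\<Sum>j<d. expectation (\<lambda>w. \<bar>g (\<eta> 0 w) j\<bar> ^ m))"
  have \<Gamma>: "expectation (\<lambda>w. \<bar>g (\<eta> 0 w) j\<bar> ^ m) \<le> \<Gamma>" "0 \<le> \<Gamma>" if "j < d" for j
    using that unfolding \<Gamma>_def by (auto intro!: member_le_sum sum_nonneg)
  \<comment> \<open>The total weight of the full geometric series over all lags and \<open>d\<close>
    coordinates, a bound for each partial sum.\<close>
  define W where "W = real d / (1 - \<theta>)"
  define R where "R n w = (\<Sum>(k, j)\<in>{..<n} \<times> {..<d}. weight k t i j w * \<bar>g (\<eta> (t - int k) w) j\<bar>)" for n w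
  define V where "V n w = (\<Sum>j<d. weight n t i j w * \<bar>X (t - int n) w j\<bar>)" for n w
  have W_bound: "(\<Sum>(k, j)\<in>{..<n} \<times> {..<d}. \<theta> ^ k) \<le> W" for n
  proof -
    have "(\<Sum>(k, j)\<in>{..<n} \<times> {..<d}. \<theta> ^ k) = real d * (\<Sum>k<n. \<theta> ^ k)"
      by (simp add: sum.cartesian_product[symmetric] sum_distrib_left)
    also have "(\<Sum>k<n. \<theta> ^ k) \<le> 1 / (1 - \<theta>)"
      using \<theta> by (simp add: sum_gp_strict field_simps)
    finally show ?thesis by (simp add: W_def mult_left_mono)
  qed
  have g_meas: "(\<lambda>w. g (\<eta> u w) j) \<in> borel_measurable M" if "j < d" for u j
    by (rule measurable_compose[OF eta_measurable g_measurable[OF that]])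
  have R_meas: "R n \<in> borel_measurable M" for n
    unfolding R_def using g_meas weight_measurable[OF i]
    by (intro borel_measurable_sum) (auto split: prod.splits intro!: borel_measurable_times borel_measurable_abs)
  have R_nonneg: "0 \<le> R n w" for n w
    unfolding R_def by (intro sum_nonneg) (auto intro!: mult_nonneg_nonneg weight_nonneg i)
  let ?x = "\<lambda>w (k, j). weight k t i j w * \<bar>g (\<eta> (t - int k) w) j\<bar>"
  let ?B = "\<lambda>n w. W ^ (m - 1) * (\<Sum>p\<in>{..<n} \<times> {..<d}. ?x w p ^ m / (\<theta> ^ fst p) ^ (m - 1))"
  have R_le: "R n w ^ m \<le> ?B n w" for n w
  proof -
    have "R n w ^ m \<le> (\<Sum>p\<in>{..<n} \<times> {..<d}. \<theta> ^ fst p) ^ (m - 1)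
        * (\<Sum>p\<in>{..<n} \<times> {..<d}. ?x w p ^ m / (\<theta> ^ fst p) ^ (m - 1))"
      unfolding R_def using \<theta> m_pos
      by (intro sum_power_le_weighted) (auto intro!: mult_nonneg_nonneg weight_nonneg i)
    also have "\<dots> \<le> ?B n w"
      using W_bound[of n] \<theta>
      by (intro mult_right_mono power_mono)
        (auto simp: case_prod_beta intro!: sum_nonneg divide_nonneg_nonneg zero_le_power mult_nonneg_nonneg weight_nonneg i)
    finally show ?thesis .
  qed
  have x_int: "integrable M (\<lambda>w. ?x w p ^ m)" if p: "p \<in> {..<n} \<times> {..<d}" for p n
    using p noise_moment(1)[OF i _ cs(4)[OF i]] by auto
  have B_int: "integrable M (?B n)" for n
    using x_int by (intro integrable_mult_right Bochner_Integration.integrable_sum integrable_divide) auto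
  have x_le: "expectation (\<lambda>w. ?x w p ^ m) \<le> c * \<Gamma> * (\<theta> ^ fst p) ^ m" if p: "p \<in> {..<n} \<times> {..<d}" for p n
  proof -
    obtain k j where kj: "p = (k, j)" "j < d" using p by auto
    have "expectation (\<lambda>w. ?x w p ^ m) =
        expectation (\<lambda>w. weight k t i j w ^ m) * expectation (\<lambda>w. \<bar>g (\<eta> 0 w) j\<bar> ^ m)"
      using noise_moment(2)[OF i kj(2) cs(4)[OF i kj(2)]] by (simp add: kj)
    also have "\<dots> \<le> (c * s ^ k) * \<Gamma>"
      using cs \<Gamma>[OF kj(2)] i kj by (intro mult_mono) auto
    also have "s ^ k = (\<theta> ^ k) ^ m" by (simp add: \<theta>(3)[symmetric] mult.commute flip: power_mult)
    finally show ?thesis by (simp add: kj ac_simps)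
  qed
  have B_le: "expectation (?B n) \<le> W ^ (m - 1) * (c * \<Gamma> * W)" for n
  proof -
    have "expectation (?B n) =
        W ^ (m - 1) * (\<Sum>p\<in>{..<n} \<times> {..<d}. expectation (\<lambda>w. ?x w p ^ m) / (\<theta> ^ fst p) ^ (m - 1))"
      using x_int by (subst integral_mult_right_zero) (simp add: Bochner_Integration.integral_sum)
    also have "\<dots> \<le> W ^ (m - 1) * (\<Sum>p\<in>{..<n} \<times> {..<d}. c * \<Gamma> * \<theta> ^ fst p)"
    proof (intro mult_left_mono sum_mono)
      fix p assume p: "p \<in> {..<n} \<times> {..<d}"
      have "expectation (\<lambda>w. ?x w p ^ m) / (\<theta> ^ fst p) ^ (m - 1) \<le>
          c * \<Gamma> * (\<theta> ^ fst p) ^ m / (\<theta> ^ fst p) ^ (m - 1)"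
        using x_le[OF p] \<theta> by (intro divide_right_mono) auto
      also have "\<dots> = c * \<Gamma> * \<theta> ^ fst p"
        using \<theta> m_pos by (cases m) auto
      finally show "expectation (\<lambda>w. ?x w p ^ m) / (\<theta> ^ fst p) ^ (m - 1) \<le> c * \<Gamma> * \<theta> ^ fst p" .
    qed (use \<theta> in \<open>simp add: W_def\<close>)
    also have "\<dots> \<le> W ^ (m - 1) * (c * \<Gamma> * W)"
    proof -
      have "(\<Sum>p\<in>{..<n} \<times> {..<d}. \<theta> ^ fst p) \<le> W"
        using W_bound[of n] by (simp add: case_prod_beta)
      then have "c * \<Gamma> * (\<Sum>p\<in>{..<n} \<times> {..<d}. \<theta> ^ fst p) \<le> c * \<Gamma> * W"
        using cs(3) \<Gamma>(2)[OF i] by (intro mult_left_mono) auto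
      moreover have "0 \<le> W ^ (m - 1)" using \<theta> by (simp add: W_def)
      ultimately show ?thesis
        unfolding sum_distrib_left[symmetric] by (rule mult_left_mono)
    qed
    finally show ?thesis .
  qed
  have R_int: "integrable M (\<lambda>w. R n w ^ m)" for n
  proof (rule Bochner_Integration.integrable_bound[OF B_int[of n]])
    show "(\<lambda>w. R n w ^ m) \<in> borel_measurable M"
      by (intro borel_measurable_power R_meas)
    have "norm (R n w ^ m) \<le> norm (?B n w)" for w
      using R_le[of n w] R_nonneg[of n w] by (simp only: real_norm_def) simp
    then show "AE w in M. norm (R n w ^ m) \<le> norm (?B n w)" by (intro AE_I2)
  qed
  show ?thesis
  proof (rule integrable_power_of_approx)
    show "(\<lambda>w. X t w i) \<in> borel_measurable M" by (rule X_measurable[OF i])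
    show "V n \<in> borel_measurable M" for n
      unfolding V_def using X_measurable weight_measurable[OF i]
      by (intro borel_measurable_sum) (auto intro!: borel_measurable_times borel_measurable_abs)
    show "integrable M (\<lambda>w. R n w ^ m)" "0 \<le> R n w" for n w by (fact R_int, fact R_nonneg)
    show "(\<integral>w. R n w ^ m \<partial>M) \<le> W ^ (m - 1) * (c * \<Gamma> * W)" for n
      using integral_mono[OF R_int B_int R_le, of n] B_le[of n] by linarith
    show "AE w in M. \<bar>X t w i\<bar> \<le> R n w + V n w" for n
      using iterated_recursion unfolding R_def V_def by eventually_elim (use i in blast)
    show "\<exists>n. prob {w \<in> space M. V n w > 1} \<le> \<delta>" if "0 < \<delta>" for \<delta>
      unfolding V_def by (rule remainder_small[OF i that])
  qed
qed

end

section \<open>Log-moments, tightness and stationarity\<close>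

lemma integrable_abs_power_mult:
  assumes "integrable M (\<lambda>w. \<bar>f w :: real\<bar> ^ m)"
  shows "integrable M (\<lambda>w. \<bar>c * f w\<bar> ^ m)"
  using assms by (simp add: abs_mult power_mult_distrib)

lemma integrable_abs_power_le:
  fixes f :: "'a \<Rightarrow> real"
  assumes f: "integrable M (\<lambda>w. \<bar>f w\<bar> ^ m)" and h: "h \<in> borel_measurable M"
    and le: "AE w in M. \<bar>h w\<bar> \<le> \<bar>f w\<bar>"
  shows "integrable M (\<lambda>w. \<bar>h w :: real\<bar> ^ m)"
proof (rule Bochner_Integration.integrable_bound[OF f])
  show "AE w in M. norm (\<bar>h w\<bar> ^ m) \<le> norm (\<bar>f w\<bar> ^ m)"
    using le by eventually_elim (auto intro: power_mono)
qed (use h in simp)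

lemma integrable_abs_power_add:
  fixes f g :: "'a \<Rightarrow> real"
  assumes [measurable]: "f \<in> borel_measurable M" "g \<in> borel_measurable M"
    and int: "integrable M (\<lambda>w. \<bar>f w\<bar> ^ m)" "integrable M (\<lambda>w. \<bar>g w\<bar> ^ m)"
  shows "integrable M (\<lambda>w. \<bar>f w + g w\<bar> ^ m)"
proof (rule Bochner_Integration.integrable_bound)
  show "integrable M (\<lambda>w. 2 ^ m * (\<bar>f w\<bar> ^ m + \<bar>g w\<bar> ^ m))"
    using int by (intro integrable_mult_right Bochner_Integration.integrable_add)
  show "AE w in M. norm (\<bar>f w + g w\<bar> ^ m) \<le> norm (2 ^ m * (\<bar>f w\<bar> ^ m + \<bar>g w\<bar> ^ m))"
  proof (rule AE_I2)
    fix w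
    have "\<bar>f w + g w\<bar> ^ m \<le> (2 * max \<bar>f w\<bar> \<bar>g w\<bar>) ^ m" by (intro power_mono) auto
    also have "\<dots> \<le> 2 ^ m * (\<bar>f w\<bar> ^ m + \<bar>g w\<bar> ^ m)"
      by (auto simp: power_mult_distrib max_def)
    finally show "norm (\<bar>f w + g w\<bar> ^ m) \<le> norm (2 ^ m * (\<bar>f w\<bar> ^ m + \<bar>g w\<bar> ^ m))" by simp
  qed
qed simp

lemma integrable_abs_power_sum:
  fixes f :: "'i \<Rightarrow> 'a \<Rightarrow> real"
  assumes m: "m > 0" and "finite I"
    and "\<And>i. i \<in> I \<Longrightarrow> f i \<in> borel_measurable M"
    and "\<And>i. i \<in> I \<Longrightarrow> integrable M (\<lambda>w. \<bar>f i w\<bar> ^ m)"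
  shows "integrable M (\<lambda>w. \<bar>\<Sum>i\<in>I. f i w\<bar> ^ m)"
  using assms(2-)
proof (induction I)
  case empty
  then show ?case using m by (simp add: power_0_left)
next
  case (insert i I)
  then show ?case
    using integrable_abs_power_add[of "f i" M "\<lambda>w. \<Sum>i\<in>I. f i w" m] by simp
qed

text \<open>A positive exponent makes the value infinite where the logarithm is
  \<open>-\<infinity>\<close>; a zero exponent would give 1 there.\<close>

lemma e2ennreal_abs_elog_power:
  assumes "m > 0"
  shows "e2ennreal (\<bar>elog x\<bar> ^ m) = (if x \<le> 0 then \<top> else ennreal (\<bar>ln x\<bar> ^ m))"
  using assms by (simp add: elog_def)

lemma abs_log_moment_finite:
  assumes m: "m > 0" and X: "X \<in> borel_measurable M" "AE w in M. X w > 0"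
    and int: "integrable M (\<lambda>w. \<bar>ln (X w)\<bar> ^ m)"
  shows "abs_log_moment M m X < \<infinity>"
proof -
  have "abs_log_moment M m X = (\<integral>\<^sup>+w. ennreal (\<bar>ln (X w)\<bar> ^ m) \<partial>M)"
    unfolding abs_log_moment_def e2ennreal_abs_elog_power[OF m]
    using X(2) by (intro nn_integral_cong_AE) (auto elim: eventually_mono)
  also have "\<dots> < \<infinity>"
    using int by (subst nn_integral_eq_integral) auto
  finally show ?thesis .
qed

text \<open>The integrand is infinite wherever \<open>X w \<le> 0\<close>, so a finite integral
  makes that set null; elsewhere it is the ordinary power of the real logarithm.\<close>

lemma abs_log_moment_finiteD:
  assumes m: "m > 0" and X [measurable]: "X \<in> borel_measurable M" and fin: "abs_log_moment M m X < \<infinity>"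
  shows "AE w in M. X w > 0" "integrable M (\<lambda>w. \<bar>ln (X w)\<bar> ^ m)"
proof -
  let ?f = "\<lambda>w. if X w \<le> 0 then \<top> else ennreal (\<bar>ln (X w)\<bar> ^ m)"
  have fin': "(\<integral>\<^sup>+w. ?f w \<partial>M) < \<infinity>"
    using fin unfolding abs_log_moment_def e2ennreal_abs_elog_power[OF m] .
  have "AE w in M. ?f w \<noteq> \<infinity>"
    using fin' by (intro nn_integral_PInf_AE) auto
  then show "AE w in M. X w > 0" by eventually_elim (auto split: if_splits)
  have "(\<integral>\<^sup>+w. ennreal (\<bar>ln (X w)\<bar> ^ m) \<partial>M) \<le> (\<integral>\<^sup>+w. ?f w \<partial>M)"
    by (intro nn_integral_mono) auto
  then show "integrable M (\<lambda>w. \<bar>ln (X w)\<bar> ^ m)"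
    using fin' by (intro integrableI_bounded) (auto simp: power_abs)
qed

section \<open>Kronecker moments under transposition and change of time\<close>

lemma kronecker_transpose: "kronecker (transpose_mat A) (transpose_mat B) = transpose_mat (kronecker A B)"
proof (rule eq_matI)
  fix i j
  assume "i < dim_row (transpose_mat (kronecker A B))" "j < dim_col (transpose_mat (kronecker A B))"
  then have ij: "i < dim_col A * dim_col B" "j < dim_row A * dim_row B" by auto
  then have "0 < dim_col B" "0 < dim_row B" by (auto intro: gr0I)
  then show "kronecker (transpose_mat A) (transpose_mat B) $$ (i, j) = transpose_mat (kronecker A B) $$ (i, j)"
    using ij by (simp add: kronecker_def less_mult_imp_div_less)
qed auto

lemma kronecker_power_transpose: "kronecker_power (transpose_mat A) m = transpose_mat (kronecker_power A m)"
  by (induction m) (simp_all add: kronecker_transpose)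

lemma abs_kronecker_moment_transpose:
  assumes X: "\<And>w. X w \<in> carrier_mat d d"
  shows "abs_kronecker_moment M d m (\<lambda>w. transpose_mat (X w)) = transpose_mat (abs_kronecker_moment M d m X)"
proof (rule eq_matI)
  fix i j
  assume "i < dim_row (transpose_mat (abs_kronecker_moment M d m X))"
    "j < dim_col (transpose_mat (abs_kronecker_moment M d m X))"
  then have ij: "i < d ^ m" "j < d ^ m" by (simp_all add: abs_kronecker_moment_def)
  have "map_mat abs (transpose_mat (X w)) = transpose_mat (map_mat abs (X w))" for w
    by (rule map_mat_transpose[symmetric])
  then have "kronecker_power (map_mat abs (transpose_mat (X w))) m $$ (i, j) =
      kronecker_power (map_mat abs (X w)) m $$ (j, i)" for w
    using ij carrier_matD[OF kronecker_power_carrier[OF map_carrier_mat[THEN iffD2, OF X], of abs w m]]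
    by (simp add: kronecker_power_transpose)
  then show "abs_kronecker_moment M d m (\<lambda>w. transpose_mat (X w)) $$ (i, j) =
      transpose_mat (abs_kronecker_moment M d m X) $$ (i, j)"
    using ij by (simp add: abs_kronecker_moment_def)
qed (simp_all add: abs_kronecker_moment_def)

text \<open>Only the law of the innovation matters. This reconciles the matrix at time 1 in the
  theorem with the one at time 0 in \<open>random_affine_recursion\<close>.\<close>

lemma abs_kronecker_moment_ident:
  fixes \<eta> :: "int \<Rightarrow> 's \<Rightarrow> real"
  assumes \<eta>: "\<And>t. \<eta> t \<in> borel_measurable M" "distr M borel (\<eta> s) = distr M borel (\<eta> t)"
    and F: "\<And>x. F x \<in> carrier_mat d d"
    and F_meas: "\<And>i j. i < d \<Longrightarrow> j < d \<Longrightarrow> (\<lambda>x. F x $$ (i, j)) \<in> borel_measurable borel"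
  shows "abs_kronecker_moment M d m (\<lambda>w. F (\<eta> s w)) = abs_kronecker_moment M d m (\<lambda>w. F (\<eta> t w))"
proof -
  let ?K = "\<lambda>x. kronecker_power (map_mat abs (F x)) m"
  have "(\<lambda>x. map_mat abs (F x) $$ (i, j)) \<in> borel_measurable borel" if "i < d" "j < d" for i j
    using F_meas[OF that] that carrier_matD[OF F] by simp
  then have K: "(\<lambda>x. ?K x $$ (i, j)) \<in> borel_measurable borel" if "i < d ^ m" "j < d ^ m" for i j
    using F that by (intro kronecker_power_entry_measurable) auto
  have "(\<integral>w. ?K (\<eta> s w) $$ (i, j) \<partial>M) = (\<integral>w. ?K (\<eta> t w) $$ (i, j) \<partial>M)" if "i < d ^ m" "j < d ^ m" for i j
  proof -
    have "integral\<^sup>L (distr M borel (\<eta> s)) (\<lambda>x. ?K x $$ (i, j)) =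
        integral\<^sup>L (distr M borel (\<eta> t)) (\<lambda>x. ?K x $$ (i, j))"
      by (simp only: \<eta>(2))
    then show ?thesis using \<eta>(1) K[OF that] by (simp add: integral_distr)
  qed
  then show ?thesis unfolding abs_kronecker_moment_def by (intro eq_matI) simp_all
qed

section \<open>Tightness of families indexed by time\<close>

definition tight_family :: "'s measure \<Rightarrow> (int \<Rightarrow> 's \<Rightarrow> real) \<Rightarrow> bool" where
  "tight_family M Y \<longleftrightarrow> (\<forall>\<delta>>0. \<exists>B. \<forall>t. measure M {w \<in> space M. \<bar>Y t w\<bar> > B} \<le> \<delta>)"

text \<open>A single real random variable is tight by continuity from above, as the events
  \<open>\<bar>Y 0\<bar> > n\<close> decrease to the empty set; equal tail probabilities carry the
  bound to all times.\<close>

lemma (in prob_space) tight_family_ident: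
  assumes Y: "Y 0 \<in> borel_measurable M"
    and eq: "\<And>t B. prob {w \<in> space M. \<bar>Y t w\<bar> > B} = prob {w \<in> space M. \<bar>Y 0 w\<bar> > B}"
  shows "tight_family M Y"
  unfolding tight_family_def
proof (intro allI impI)
  fix \<delta> :: real assume \<delta>: "0 < \<delta>"
  let ?A = "\<lambda>n::nat. {w \<in> space M. \<bar>Y 0 w\<bar> > real n}"
  have "(\<lambda>n. prob (?A n)) \<longlonglongrightarrow> prob (\<Inter>n. ?A n)"
  proof (rule finite_Lim_measure_decseq)
    show "range ?A \<subseteq> sets M" using Y by auto
    show "decseq ?A" by (rule decseq_SucI) auto
  qed
  also have "(\<Inter>n. ?A n) = {}"
  proof (rule equals0I)
    fix w assume w: "w \<in> (\<Inter>n. ?A n)"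
    obtain n where "\<bar>Y 0 w\<bar> \<le> real n" using real_arch_simple by blast
    moreover have "w \<in> ?A n" using w by blast
    ultimately show False by simp
  qed
  finally have "\<forall>\<^sub>F n in sequentially. prob (?A n) < \<delta>"
    using \<delta> by (intro order_tendstoD(2)) auto
  then obtain n where n: "prob (?A n) < \<delta>" unfolding eventually_sequentially by blast
  have "prob {w \<in> space M. \<bar>Y t w\<bar> > real n} \<le> \<delta>" for t
    by (subst eq) (rule less_imp_le[OF n])
  then show "\<exists>B. \<forall>t. prob {w \<in> space M. \<bar>Y t w\<bar> > B} \<le> \<delta>" by blast
qed

lemma tight_family_shift: "tight_family M Y \<Longrightarrow> tight_family M (\<lambda>t. Y (t - h))"
  unfolding tight_family_def by blast

lemma (in prob_space) tight_family_sum: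
  assumes "finite I" "\<And>i t. i \<in> I \<Longrightarrow> Y i t \<in> borel_measurable M" "\<And>i. i \<in> I \<Longrightarrow> tight_family M (Y i)"
  shows "tight_family M (\<lambda>t w. \<Sum>i\<in>I. Y i t w)"
  using assms
proof (induction I)
  case empty
  show ?case unfolding tight_family_def by (auto intro!: exI[of _ 0])
next
  case (insert i I)
  let ?S = "\<lambda>t w. \<Sum>i\<in>I. Y i t w"
  have tight: "tight_family M (Y i)" "tight_family M ?S" using insert by auto
  have meas [measurable]: "Y i t \<in> borel_measurable M" "?S t \<in> borel_measurable M" for t
    using insert by auto
  show ?case unfolding tight_family_def
  proof (intro allI impI)
    fix \<delta> :: real assume \<delta>: "0 < \<delta>"
    then have "0 < \<delta> / 2" by simp
    with tight obtain B B' where B: "\<And>t. prob {w \<in> space M. \<bar>Y i t w\<bar> > B} \<le> \<delta> / 2"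
      "\<And>t. prob {w \<in> space M. \<bar>?S t w\<bar> > B'} \<le> \<delta> / 2"
      unfolding tight_family_def by blast
    have "prob {w \<in> space M. \<bar>\<Sum>i\<in>insert i I. Y i t w\<bar> > B + B'} \<le> \<delta>" for t
    proof -
      have "prob {w \<in> space M. \<bar>\<Sum>i\<in>insert i I. Y i t w\<bar> > B + B'} \<le>
          prob ({w \<in> space M. \<bar>Y i t w\<bar> > B} \<union> {w \<in> space M. \<bar>?S t w\<bar> > B'})"
        using insert.hyps by (intro finite_measure_mono) auto
      also have "\<dots> \<le> prob {w \<in> space M. \<bar>Y i t w\<bar> > B} + prob {w \<in> space M. \<bar>?S t w\<bar> > B'}"
        by (rule measure_Un_le) measurable
      finally show ?thesis using B(1)[of t] B(2)[of t] by linarith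
    qed
    then show "\<exists>B. \<forall>t. prob {w \<in> space M. \<bar>\<Sum>i\<in>insert i I. Y i t w\<bar> > B} \<le> \<delta>" by blast
  qed
qed

text \<open>Stationarity for the index set \<open>{0}\<close> says that all \<open>X t\<close> have
  the law of \<open>X 0\<close>, so the tails of \<open>f (X t)\<close> agree.\<close>

lemma (in prob_space) tight_family_stationary:
  assumes stat: "strictly_stationary M X" and f: "f \<in> borel_measurable borel"
  shows "tight_family M (\<lambda>t w. f (X t w))"
proof (rule tight_family_ident)
  have X: "X t \<in> measurable M borel" for t using stat by (simp add: strictly_stationary_def)
  show "(\<lambda>w. f (X 0 w)) \<in> borel_measurable M" by (rule measurable_compose[OF X f])
  fix t :: int and B :: real
  let ?N = "PiM {0::int} (\<lambda>_. borel)" and ?r = "\<lambda>t w. \<lambda>s\<in>{0::int}. X (s + t) w"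
  let ?A = "{x \<in> space ?N. \<bar>f (x 0)\<bar> > B}"
  have "(\<lambda>x. x 0) \<in> measurable ?N borel" by (rule measurable_component_singleton) simp
  from measurable_compose[OF this f] have A: "?A \<in> sets ?N" by measurable
  have r: "?r t \<in> measurable M ?N" for t
    using X by (intro measurable_restrict) auto
  have eq: "prob {w \<in> space M. \<bar>f (X t w)\<bar> > B} = measure (distr M ?N (?r t)) ?A" for t
    unfolding measure_distr[OF r A]
    by (intro arg_cong[where f = prob]) (auto simp: space_PiM)
  have "distr M ?N (?r t) = distr M ?N (?r 0)"
    using stat unfolding strictly_stationary_def by simp
  then show "prob {w \<in> space M. \<bar>f (X t w)\<bar> > B} = prob {w \<in> space M. \<bar>f (X 0 w)\<bar> > B}"
    unfolding eq by simp
qed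

section \<open>Stationary solutions of the log-GARCH model\<close>

locale stationary_log_garch = prob_space M for M :: "'s measure" +
  fixes p q m :: nat and \<omega> :: real and ap am \<beta> :: "nat \<Rightarrow> real"
    and \<eta> \<epsilon> \<sigma> :: "int \<Rightarrow> 's \<Rightarrow> real"
  assumes innovations: "log_garch_innovations M \<eta>"
    and m_pos: "m > 0"
    and eta_moment: "abs_log_moment M m (\<lambda>w. (\<eta> 0 w)\<^sup>2) < \<infinity>"
    and solution: "log_garch_solution M p q \<omega> ap am \<beta> \<eta> \<epsilon> \<sigma>"
    and stationary: "strictly_stationary M (\<lambda>t w. (\<epsilon> t w, \<sigma> t w))"
begin

lemma indep_eta: "indep_vars (\<lambda>_. borel) \<eta> UNIV"
  using innovations by (simp add: log_garch_innovations_def)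

lemma ident_eta: "distr M borel (\<eta> t) = distr M borel (\<eta> 0)"
  using innovations by (simp add: log_garch_innovations_def)

lemma measurable_processes [measurable]:
  "\<eta> t \<in> borel_measurable M" "\<epsilon> t \<in> borel_measurable M" "\<sigma> t \<in> borel_measurable M"
  using indep_eta solution by (auto simp: indep_vars_def log_garch_solution_def)

text \<open>The finite log-moment excludes zero at time 0, and the common law transfers this to
  every time.\<close>

lemma eta_nonzero: "AE w in M. \<eta> t w \<noteq> 0"
proof -
  have "AE w in M. (\<eta> 0 w)\<^sup>2 > 0"
    using m_pos eta_moment by (intro abs_log_moment_finiteD) auto
  then have "AE x in distr M borel (\<eta> 0). x \<noteq> 0" by (simp add: AE_distr_iff)
  then have "AE x in distr M borel (\<eta> t). x \<noteq> 0" by (simp only: ident_eta[of t])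
  then show ?thesis by (simp add: AE_distr_iff)
qed

lemma ln_eta_moment: "integrable M (\<lambda>w. \<bar>ln ((\<eta> t w)\<^sup>2)\<bar> ^ m)"
proof -
  have "integrable M (\<lambda>w. \<bar>ln ((\<eta> 0 w)\<^sup>2)\<bar> ^ m)"
    using m_pos eta_moment by (intro abs_log_moment_finiteD) auto
  then have "integrable (distr M borel (\<eta> 0)) (\<lambda>x. \<bar>ln (x\<^sup>2)\<bar> ^ m)" by (simp add: integrable_distr_eq)
  then have "integrable (distr M borel (\<eta> t)) (\<lambda>x. \<bar>ln (x\<^sup>2)\<bar> ^ m)" by (simp only: ident_eta[of t])
  then show ?thesis by (simp add: integrable_distr_eq)
qed

text \<open>The joint contribution of lag \<open>i\<close> to the log-volatility. The case
  distinctions pad both coefficient sequences with zeros, so that one sum up to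
  \<open>max p q\<close> covers both kinds of lags.\<close>

definition log_arch_term :: "nat \<Rightarrow> real \<Rightarrow> real \<Rightarrow> real" where
  "log_arch_term i e s =
     (if i \<le> q then (ap i * of_bool (e > 0) + am i * of_bool (e < 0)) * ln (e\<^sup>2) else 0)
     + (if i \<le> p then \<beta> i * ln (s\<^sup>2) else 0)"

text \<open>Collects the countably many almost sure statements, including nonzero innovations, on
  one null set.\<close>

lemma model:
  "AE w in M. \<forall>t. \<sigma> t w > 0 \<and> \<eta> t w \<noteq> 0 \<and> \<epsilon> t w = \<sigma> t w * \<eta> t w \<and>
     ln ((\<sigma> t w)\<^sup>2) = \<omega>
       + (\<Sum>i=1..q. (ap i * of_bool (\<epsilon> (t - int i) w > 0) + am i * of_bool (\<epsilon> (t - int i) w < 0))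
                    * ln ((\<epsilon> (t - int i) w)\<^sup>2))
       + (\<Sum>j=1..p. \<beta> j * ln ((\<sigma> (t - int j) w)\<^sup>2))"
proof -
  have "AE w in M. \<eta> t w \<noteq> 0 \<and> (\<sigma> t w > 0 \<and> \<epsilon> t w = \<sigma> t w * \<eta> t w \<and>
     ln ((\<sigma> t w)\<^sup>2) = \<omega>
       + (\<Sum>i=1..q. (ap i * of_bool (\<epsilon> (t - int i) w > 0) + am i * of_bool (\<epsilon> (t - int i) w < 0))
                    * ln ((\<epsilon> (t - int i) w)\<^sup>2))
       + (\<Sum>j=1..p. \<beta> j * ln ((\<sigma> (t - int j) w)\<^sup>2)))" for t
    using eta_nonzero[of t] solution unfolding log_garch_solution_def by (auto simp only: AE_conj_iff)
  then show ?thesis unfolding AE_all_countable by (rule allI[OF eventually_mono]) blast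
qed

text \<open>Since \<sigma> is positive and \<eta> nonzero, the logarithm of the squared observation
  is the sum of those of the squared volatility and the squared innovation. It thus suffices to
  treat the volatility.\<close>

lemma log_moments_finite:
  assumes int: "integrable M (\<lambda>w. \<bar>ln ((\<sigma> t w)\<^sup>2)\<bar> ^ m)"
  shows "abs_log_moment M m (\<lambda>w. (\<epsilon> t w)\<^sup>2) < \<infinity>" "abs_log_moment M m (\<lambda>w. (\<sigma> t w)\<^sup>2) < \<infinity>"
proof -
  have \<sigma>: "AE w in M. (\<sigma> t w)\<^sup>2 > 0" using model by eventually_elim (metis zero_less_power)
  then show "abs_log_moment M m (\<lambda>w. (\<sigma> t w)\<^sup>2) < \<infinity>"
    using m_pos int by (intro abs_log_moment_finite) auto
  have "AE w in M. (\<epsilon> t w)\<^sup>2 > 0"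
    using model by eventually_elim (metis mult_eq_0_iff not_less_iff_gr_or_eq zero_less_power2)
  moreover have "integrable M (\<lambda>w. \<bar>ln ((\<epsilon> t w)\<^sup>2)\<bar> ^ m)"
  proof (rule integrable_abs_power_le)
    show "integrable M (\<lambda>w. \<bar>ln ((\<sigma> t w)\<^sup>2) + ln ((\<eta> t w)\<^sup>2)\<bar> ^ m)"
      using int ln_eta_moment by (intro integrable_abs_power_add) auto
    show "AE w in M. \<bar>ln ((\<epsilon> t w)\<^sup>2)\<bar> \<le> \<bar>ln ((\<sigma> t w)\<^sup>2) + ln ((\<eta> t w)\<^sup>2)\<bar>"
      using model
    proof eventually_elim
      case (elim w)
      then have "\<epsilon> t w = \<sigma> t w * \<eta> t w" "\<sigma> t w > 0" "\<eta> t w \<noteq> 0" by auto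
      then show ?case by (simp add: power_mult_distrib ln_mult)
    qed
  qed simp
  ultimately show "abs_log_moment M m (\<lambda>w. (\<epsilon> t w)\<^sup>2) < \<infinity>"
    using m_pos by (intro abs_log_moment_finite) auto
qed

end

section \<open>The state vector of the matrices C\<close>

lemma sum_lessThan_add:
  fixes f :: "nat \<Rightarrow> 'a :: comm_monoid_add"
  shows "(\<Sum>j<a + b. f j) = (\<Sum>j<a. f j) + (\<Sum>j<b. f (a + j))"
  by (induction b) (simp_all add: add.assoc)

context stationary_log_garch
begin

text \<open>Three blocks: positive parts and negative parts of the observations at lags 0 to
  \<open>q - 1\<close>, then volatilities at lags 0 to \<open>p - 1\<close>. Counting lags from 0
  makes the vector at \<open>t - 1\<close> hold exactly the regressors at time
  \<open>t\<close>.\<close>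

definition C_state :: "int \<Rightarrow> 's \<Rightarrow> nat \<Rightarrow> real" where
  "C_state t w i =
     (if i < q then of_bool (\<epsilon> (t - int i) w > 0) * ln ((\<epsilon> (t - int i) w)\<^sup>2)
      else if i < 2 * q then of_bool (\<epsilon> (t - int (i - q)) w < 0) * ln ((\<epsilon> (t - int (i - q)) w)\<^sup>2)
      else ln ((\<sigma> (t - int (i - 2 * q)) w)\<^sup>2))"

text \<open>Row \<open>2 * q\<close> is tested first, as in \<open>C_mat\<close>, so that the two
  agree when \<open>q = 0\<close>.\<close>

definition C_noise :: "real \<Rightarrow> nat \<Rightarrow> real" where
  "C_noise x i =
     (if i = 2 * q then \<omega>
      else if i = 0 then of_bool (x > 0) * (\<omega> + ln (x\<^sup>2))
      else if i = q then of_bool (x < 0) * (\<omega> + ln (x\<^sup>2))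
      else 0)"

lemma C_state_measurable: "(\<lambda>w. C_state t w i) \<in> borel_measurable M"
  unfolding C_state_def by measurable

lemma C_state_tight: "tight_family M (\<lambda>t w. C_state t w i)"
proof -
  let ?f = "\<lambda>(e, s). of_bool (e > 0) * ln (e\<^sup>2) :: real"
    and ?g = "\<lambda>(e, s). of_bool (e < 0) * ln (e\<^sup>2) :: real" and ?h = "\<lambda>(e, s). ln (s\<^sup>2) :: real"
  have meas: "?f \<in> borel_measurable (borel :: (real \<times> real) measure)"
    "?g \<in> borel_measurable (borel :: (real \<times> real) measure)"
    "?h \<in> borel_measurable (borel :: (real \<times> real) measure)"
    \<comment> \<open>The Borel algebra of the plane is rewritten as a product so that measurability
      can be checked by coordinates.\<close>
    unfolding borel_prod[symmetric] by measurable
  note tight = meas[THEN tight_family_stationary[OF stationary], THEN tight_family_shift]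
  consider "i < q" | "\<not> i < q" "i < 2 * q" | "\<not> i < 2 * q" "\<not> i < q" by linarith
  then show ?thesis
  proof cases
    case 1
    then show ?thesis using tight(1)[of "int i"] by (simp add: C_state_def)
  next
    case 2
    then show ?thesis using tight(2)[of "int (i - q)"] by (simp add: C_state_def)
  next
    case 3
    then show ?thesis using tight(3)[of "int (i - 2 * q)"] by (simp add: C_state_def)
  qed
qed

lemma C_coeff_state_sum:
  "(\<Sum>j<2 * q + p. C_coeff q ap am \<beta> j * C_state (t - 1) w j) =
     (\<Sum>i=1..q. (ap i * of_bool (\<epsilon> (t - int i) w > 0) + am i * of_bool (\<epsilon> (t - int i) w < 0))
                    * ln ((\<epsilon> (t - int i) w)\<^sup>2))
     + (\<Sum>j=1..p. \<beta> j * ln ((\<sigma> (t - int j) w)\<^sup>2))"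
proof -
  let ?f = "\<lambda>j. C_coeff q ap am \<beta> j * C_state (t - 1) w j"
  let ?e = "\<lambda>j. \<epsilon> (t - int (Suc j)) w" and ?s = "\<lambda>j. \<sigma> (t - int (Suc j)) w"
  have "(\<Sum>j<2 * q + p. ?f j) = (\<Sum>j<q. ?f j) + (\<Sum>j<q. ?f (q + j)) + (\<Sum>j<p. ?f (2 * q + j))"
    by (simp only: sum_lessThan_add mult_2)
  also have "(\<Sum>j<q. ?f j) = (\<Sum>j<q. ap (Suc j) * of_bool (?e j > 0) * ln ((?e j)\<^sup>2))"
    by (intro sum.cong) (simp_all add: C_coeff_def C_state_def algebra_simps)
  also have "(\<Sum>j<q. ?f (q + j)) = (\<Sum>j<q. am (Suc j) * of_bool (?e j < 0) * ln ((?e j)\<^sup>2))"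
    by (intro sum.cong) (simp_all add: C_coeff_def C_state_def algebra_simps)
  also have "(\<Sum>j<p. ?f (2 * q + j)) = (\<Sum>j<p. \<beta> (Suc j) * ln ((?s j)\<^sup>2))"
    by (intro sum.cong) (simp_all add: C_coeff_def C_state_def algebra_simps)
  finally show ?thesis
    by (simp add: sum.atLeast1_atMost_eq sum.distrib distrib_right)
qed

lemma ln_volatility:
  "AE w in M. \<forall>t. ln ((\<sigma> t w)\<^sup>2) = \<omega> + (\<Sum>j<2 * q + p. C_coeff q ap am \<beta> j * C_state (t - 1) w j)"
  unfolding C_coeff_state_sum add.assoc[symmetric] using model by eventually_elim blast

text \<open>Positivity of \<sigma> gives the observation the sign of the innovation. The rows
  \<open>0\<close>, \<open>q\<close> and \<open>2 * q\<close> therefore carry the model equation,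
  with indicators of the current innovation; the other rows shift lags.\<close>

lemma C_recursion:
  "AE w in M. \<forall>i<2 * q + p. C_state t w i =
     (\<Sum>j<2 * q + p. C_mat p q ap am \<beta> (\<eta> t w) $$ (i, j) * C_state (t - 1) w j) + C_noise (\<eta> t w) i"
  using model ln_volatility
proof eventually_elim
  case (elim w)
  let ?L = "\<Sum>j<2 * q + p. C_coeff q ap am \<beta> j * C_state (t - 1) w j"
  have pos: "\<sigma> t w > 0" "\<eta> t w \<noteq> 0" and \<epsilon>: "\<epsilon> t w = \<sigma> t w * \<eta> t w"
    using elim(1) by blast+
  have \<sigma>: "ln ((\<sigma> t w)\<^sup>2) = \<omega> + ?L" using elim by blast
  have ln_\<epsilon>: "ln ((\<epsilon> t w)\<^sup>2) = \<omega> + ?L + ln ((\<eta> t w)\<^sup>2)"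
    using pos \<sigma> by (simp add: \<epsilon> power_mult_distrib ln_mult)
  have sign: "\<epsilon> t w > 0 \<longleftrightarrow> \<eta> t w > 0" "\<epsilon> t w < 0 \<longleftrightarrow> \<eta> t w < 0"
    using pos by (auto simp: \<epsilon> zero_less_mult_iff mult_less_0_iff)
  show ?case
  proof (intro allI impI)
    fix i assume i: "i < 2 * q + p"
    consider "i = 2 * q" | "i \<noteq> 2 * q" "i = 0" | "i \<noteq> 2 * q" "i \<noteq> 0" "i = q"
      | "i \<noteq> 2 * q" "i \<noteq> 0" "i \<noteq> q" by blast
    then show "C_state t w i =
      (\<Sum>j<2 * q + p. C_mat p q ap am \<beta> (\<eta> t w) $$ (i, j) * C_state (t - 1) w j) + C_noise (\<eta> t w) i"
    proof cases
      case 1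
      then have "(\<Sum>j<2 * q + p. C_mat p q ap am \<beta> (\<eta> t w) $$ (i, j) * C_state (t - 1) w j) = ?L"
        using i by (intro sum.cong) (simp_all add: C_mat_def)
      then show ?thesis using 1 \<sigma> by (simp add: C_state_def C_noise_def)
    next
      case 2
      then have "(\<Sum>j<2 * q + p. C_mat p q ap am \<beta> (\<eta> t w) $$ (i, j) * C_state (t - 1) w j) =
          of_bool (\<eta> t w > 0) * ?L"
        using i unfolding sum_distrib_left by (intro sum.cong) (simp_all add: C_mat_def)
      then show ?thesis using 2 by (simp add: C_state_def C_noise_def ln_\<epsilon> sign)
    next
      case 3
      then have "(\<Sum>j<2 * q + p. C_mat p q ap am \<beta> (\<eta> t w) $$ (i, j) * C_state (t - 1) w j) =
          of_bool (\<eta> t w < 0) * ?L"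
        using i unfolding sum_distrib_left by (intro sum.cong) (simp_all add: C_mat_def)
      then show ?thesis using 3 by (simp add: C_state_def C_noise_def ln_\<epsilon> sign)
    next
      case 4
      have "(\<Sum>j<2 * q + p. C_mat p q ap am \<beta> (\<eta> t w) $$ (i, j) * C_state (t - 1) w j) =
          (\<Sum>j<2 * q + p. if j = i - 1 then C_state (t - 1) w (i - 1) else 0)"
        using i 4 by (intro sum.cong) (auto simp: C_mat_def)
      also have "\<dots> = C_state (t - 1) w (i - 1)" using i by simp
      \<comment> \<open>As \<open>i\<close> is none of \<open>0\<close>, \<open>q\<close>,
        \<open>2 * q\<close>, the indices \<open>i - 1\<close> and \<open>i\<close> lie in the same
        block, and one lag less at \<open>t - 1\<close> is the same time.\<close>
      also have "\<dots> = C_state t w i"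
      proof -
        have lags: "t - 1 - int (i - 1) = t - int i"
          "q < i \<Longrightarrow> t - 1 - int (i - 1 - q) = t - int (i - q)"
          "2 * q < i \<Longrightarrow> t - 1 - int (i - 1 - 2 * q) = t - int (i - 2 * q)"
          using 4 by (auto simp: of_nat_diff)
        consider "i < q" | "q < i" "i < 2 * q" | "2 * q < i" using 4 by linarith
        then show ?thesis
        proof cases
          case 1
          then have "(i - 1 < q) = True" "(i < q) = True" by auto
          then show ?thesis by (simp only: C_state_def lags(1) if_True)
        next
          case 2
          then have "(i - 1 < q) = False" "(i < q) = False" "(i - 1 < 2 * q) = True" "(i < 2 * q) = True"
            by auto
          then show ?thesis by (simp only: C_state_def lags(2)[OF 2(1)] if_True if_False)
        next
          case 3
          then have "(i - 1 < q) = False" "(i < q) = False" "(i - 1 < 2 * q) = False" "(i < 2 * q) = False"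
            by auto
          then show ?thesis by (simp only: C_state_def lags(3)[OF 3] if_False)
        qed
      qed
      finally show ?thesis using 4 by (simp add: C_noise_def)
    qed
  qed
qed

lemma noise_integrable: "integrable M (\<lambda>w. \<bar>of_bool (P (\<eta> 0 w)) * (c + ln ((\<eta> 0 w)\<^sup>2))\<bar> ^ m)"
  if "Measurable.pred borel P" for P :: "real \<Rightarrow> bool"
proof (rule integrable_abs_power_le)
  show "integrable M (\<lambda>w. \<bar>c + ln ((\<eta> 0 w)\<^sup>2)\<bar> ^ m)"
    using ln_eta_moment by (intro integrable_abs_power_add) auto
  have "(\<lambda>x. of_bool (P x) * (c + ln (x\<^sup>2)) :: real) \<in> borel_measurable borel"
    using that by measurable
  then show "(\<lambda>w. of_bool (P (\<eta> 0 w)) * (c + ln ((\<eta> 0 w)\<^sup>2)) :: real) \<in> borel_measurable M"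
    using measurable_compose[OF measurable_processes(1)] by blast
qed (auto simp: abs_mult)

text \<open>For \<open>p = 0\<close> the log-volatility is not a coordinate of
  \<open>C_state\<close>. It is therefore recovered for all \<open>p\<close> as \<omega> plus a
  linear combination of the state at \<open>t - 1\<close>.\<close>

lemma moments_from_C:
  assumes contraction: "real_spectral_radius
    (abs_kronecker_moment M (2 * q + p) m (\<lambda>w. C_mat p q ap am \<beta> (\<eta> 1 w))) < 1"
  shows "integrable M (\<lambda>w. \<bar>ln ((\<sigma> t w)\<^sup>2)\<bar> ^ m)"
proof -
  let ?d = "2 * q + p" and ?C = "C_mat p q ap am \<beta>"
  have carrier: "?C x \<in> carrier_mat ?d ?d" for x by (simp add: C_mat_def)
  have meas: "(\<lambda>x. ?C x $$ (i, j)) \<in> borel_measurable borel" if "i < ?d" "j < ?d" for i j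
    using that by (simp add: C_mat_def)
  interpret C: random_affine_recursion M \<eta> ?d m ?C C_noise C_state
  proof
    show "indep_vars (\<lambda>_. borel) \<eta> UNIV" by (rule indep_eta)
    show "distr M borel (\<eta> t) = distr M borel (\<eta> 0)" for t by (rule ident_eta)
    show "m > 0" by (rule m_pos)
    show "?C x \<in> carrier_mat ?d ?d" for x by (rule carrier)
    show "(\<lambda>x. ?C x $$ (i, j)) \<in> borel_measurable borel" if "i < ?d" "j < ?d" for i j
      by (rule meas[OF that])
    have "\<bar>?C x $$ (i, j)\<bar> \<le> 1 + (\<Sum>j<?d. \<bar>C_coeff q ap am \<beta> j\<bar>)" if "i < ?d" "j < ?d" for x i j
    proof -
      have "\<bar>?C x $$ (i, j)\<bar> \<le> 1 + \<bar>C_coeff q ap am \<beta> j\<bar>" using that by (simp add: C_mat_def abs_mult)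
      also have "\<bar>C_coeff q ap am \<beta> j\<bar> \<le> (\<Sum>j<?d. \<bar>C_coeff q ap am \<beta> j\<bar>)"
        using that by (intro member_le_sum) auto
      finally show ?thesis by simp
    qed
    then show "\<exists>K. \<forall>x i j. i < ?d \<longrightarrow> j < ?d \<longrightarrow> \<bar>?C x $$ (i, j)\<bar> \<le> K" by blast
    show "(\<lambda>x. C_noise x i) \<in> borel_measurable borel" for i
      unfolding C_noise_def by measurable
    show "integrable M (\<lambda>w. \<bar>C_noise (\<eta> 0 w) i\<bar> ^ m)" for i
      unfolding C_noise_def
      using noise_integrable[of "\<lambda>x. x > 0" \<omega>] noise_integrable[of "\<lambda>x. x < 0" \<omega>] m_pos
      by (cases "i = 2 * q"; cases "i = 0"; cases "i = q") (simp_all add: power_0_left)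
    show "(\<lambda>w. C_state t w i) \<in> borel_measurable M" for t i by (rule C_state_measurable)
    show "AE w in M. \<forall>i<?d. C_state t w i =
        (\<Sum>j<?d. ?C (\<eta> t w) $$ (i, j) * C_state (t - 1) w j) + C_noise (\<eta> t w) i" for t
      by (rule C_recursion)
    show "\<exists>B. \<forall>t. prob {w \<in> space M. \<bar>C_state t w i\<bar> > B} \<le> \<delta>" if "0 < \<delta>" for i \<delta>
      using C_state_tight[of i] that unfolding tight_family_def by blast
    have "abs_kronecker_moment M ?d m (\<lambda>w. ?C (\<eta> 1 w)) = abs_kronecker_moment M ?d m (\<lambda>w. ?C (\<eta> 0 w))"
      using measurable_processes(1) ident_eta carrier meas by (rule abs_kronecker_moment_ident)
    then show "real_spectral_radius (abs_kronecker_moment M ?d m (\<lambda>w. ?C (\<eta> 0 w))) < 1"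
      using contraction by simp
  qed
  let ?L = "\<lambda>w. \<Sum>j<?d. C_coeff q ap am \<beta> j * C_state (t - 1) w j"
  have L_meas: "?L \<in> borel_measurable M"
    by (intro borel_measurable_sum borel_measurable_times C_state_measurable) simp
  show ?thesis
  proof (rule integrable_abs_power_le)
    have "integrable M (\<lambda>w. \<bar>?L w\<bar> ^ m)"
      using C_state_measurable C.integrable_moment
      by (intro integrable_abs_power_sum[OF m_pos] integrable_abs_power_mult) auto
    then show "integrable M (\<lambda>w. \<bar>\<omega> + ?L w\<bar> ^ m)"
      using L_meas by (intro integrable_abs_power_add) auto
    show "AE w in M. \<bar>ln ((\<sigma> t w)\<^sup>2)\<bar> \<le> \<bar>\<omega> + ?L w\<bar>"
      using ln_volatility by eventually_elim simp
  qed simp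
qed

end

section \<open>The state vector of the matrices A\<close>

context stationary_log_garch
begin

abbreviation r :: nat where "r \<equiv> max p q"

text \<open>\<open>A_mat\<close> with its first row evaluated at a single innovation in place of
  different ones.\<close>

definition companion :: "real \<Rightarrow> real mat" where
  "companion x = Matrix.mat r r (\<lambda>(i, j).
     if i = 0 then mu_coeff p q ap am \<beta> (j + 1) x else of_bool (i = j + 1))"

definition arch_coeff :: "nat \<Rightarrow> real \<Rightarrow> real" where
  "arch_coeff i x = (if i \<le> q then ap i * of_bool (x > 0) + am i * of_bool (x < 0) else 0)"

text \<open>The contribution to \<open>log \<sigma>\<^sup>2\<close> at time \<open>t + 1 + a\<close> of the times up to \<open>t\<close>. In contrast to the vector
  of lagged values of \<open>log \<sigma>\<^sup>2\<close>, all coefficients of its recursion involve the same innovation.\<close>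

definition A_state :: "int \<Rightarrow> 's \<Rightarrow> nat \<Rightarrow> real" where
  "A_state t w a = (\<Sum>i=Suc a..r.
     log_arch_term i (\<epsilon> (t - (int i - int (Suc a))) w) (\<sigma> (t - (int i - int (Suc a))) w))"

text \<open>At lag 0 the new term is \<open>mu_coeff\<close> times the current log-volatility plus
  \<open>arch_coeff\<close> times the log of the squared innovation; the log-volatility itself is
  \<omega> plus \<open>A_state (t - 1) w 0\<close>, and the \<omega> goes into the noise.\<close>

definition A_noise :: "real \<Rightarrow> nat \<Rightarrow> real" where
  "A_noise x a = \<omega> * mu_coeff p q ap am \<beta> (Suc a) x + arch_coeff (Suc a) x * ln (x\<^sup>2)"

lemma log_arch_term_measurable:
  "(\<lambda>(e, s). log_arch_term i e s) \<in> borel_measurable (borel :: (real \<times> real) measure)"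
  unfolding borel_prod[symmetric] log_arch_term_def by measurable

lemma log_arch_term_process_measurable: "(\<lambda>w. log_arch_term i (\<epsilon> t w) (\<sigma> t w)) \<in> borel_measurable M"
  unfolding log_arch_term_def by measurable

lemma A_state_measurable: "(\<lambda>w. A_state t w a) \<in> borel_measurable M"
  unfolding A_state_def by (intro borel_measurable_sum log_arch_term_process_measurable)

lemma A_state_tight: "tight_family M (\<lambda>t w. A_state t w a)"
  unfolding A_state_def
proof (rule tight_family_sum)
  fix i
  have "tight_family M (\<lambda>t w. log_arch_term i (\<epsilon> t w) (\<sigma> t w))"
    using tight_family_stationary[OF stationary log_arch_term_measurable[of i]] by simp
  then show "tight_family M (\<lambda>t w. log_arch_term i (\<epsilon> (t - (int i - int (Suc a))) w)
      (\<sigma> (t - (int i - int (Suc a))) w))"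
    by (rule tight_family_shift)
qed (auto intro: log_arch_term_process_measurable)

text \<open>At \<open>a = 0\<close> all lags contribute, and the zero padding merges the sums up to
  \<open>q\<close> and up to \<open>p\<close>.\<close>

lemma ln_volatility_A: "AE w in M. \<forall>t. ln ((\<sigma> t w)\<^sup>2) = \<omega> + A_state (t - 1) w 0"
proof -
  have restrict: "(\<Sum>i=1..r. if i \<le> n then f i else 0) = (\<Sum>i=1..n. f i)" if "n \<le> r"
    for n and f :: "nat \<Rightarrow> real"
    using that by (intro sum.mono_neutral_cong_right) auto
  have lag: "t - 1 - (int i - int 1) = t - int i" for t i by simp
  have "A_state (t - 1) w 0 =
     (\<Sum>i=1..q. (ap i * of_bool (\<epsilon> (t - int i) w > 0) + am i * of_bool (\<epsilon> (t - int i) w < 0))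
                    * ln ((\<epsilon> (t - int i) w)\<^sup>2))
     + (\<Sum>j=1..p. \<beta> j * ln ((\<sigma> (t - int j) w)\<^sup>2))" for t w
    unfolding A_state_def lag log_arch_term_def sum.distrib One_nat_def[symmetric]
    by (simp only: restrict max.cobounded1 max.cobounded2)
  then show ?thesis
    unfolding add.assoc[symmetric] using model by (auto simp only: add.assoc[symmetric] elim!: eventually_mono)
qed

text \<open>The summand \<open>i = Suc a\<close> refers to time \<open>t\<close> itself; the later
  ones refer to times up to \<open>t - 1\<close> and form the next coordinate there. Lags are
  integer differences, so no subtraction is truncated.\<close>

lemma A_state_step:
  "a < r \<Longrightarrow> A_state t w a = log_arch_term (Suc a) (\<epsilon> t w) (\<sigma> t w) + A_state (t - 1) w (Suc a)"
proof -
  assume a: "a < r"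
  have lag: "t - 1 - (int i - int (Suc (Suc a))) = t - (int i - int (Suc a))" for i by simp
  have "A_state (t - 1) w (Suc a) = (\<Sum>i=Suc (Suc a)..r.
     log_arch_term i (\<epsilon> (t - (int i - int (Suc a))) w) (\<sigma> (t - (int i - int (Suc a))) w))"
    unfolding A_state_def lag ..
  then show ?thesis
    using a by (subst A_state_def, subst sum.atLeast_Suc_atMost) simp_all
qed

text \<open>Transposition moves the coefficients to column 0 and the ones above the diagonal; the
  last row has no such one.\<close>

lemma companion_transpose_sum:
  assumes a: "a < r"
  shows "(\<Sum>b<r. transpose_mat (companion x) $$ (a, b) * X b) =
    mu_coeff p q ap am \<beta> (Suc a) x * X 0 + (if Suc a < r then X (Suc a) else 0)"
proof -
  have "(\<Sum>b<r. transpose_mat (companion x) $$ (a, b) * X b) =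
      (\<Sum>b<r. (if b = 0 then mu_coeff p q ap am \<beta> (Suc a) x * X 0 else 0)
        + (if b = Suc a then X (Suc a) else 0))"
    using a by (intro sum.cong) (auto simp: companion_def)
  also have "\<dots> = mu_coeff p q ap am \<beta> (Suc a) x * X 0 + (if Suc a < r then X (Suc a) else 0)"
    using a by (subst sum.distrib) auto
  finally show ?thesis .
qed

lemma A_recursion:
  "AE w in M. \<forall>a<r. A_state t w a =
     (\<Sum>b<r. transpose_mat (companion (\<eta> t w)) $$ (a, b) * A_state (t - 1) w b) + A_noise (\<eta> t w) a"
  using model ln_volatility_A
proof eventually_elim
  case (elim w)
  have pos: "\<sigma> t w > 0" "\<eta> t w \<noteq> 0" and \<epsilon>: "\<epsilon> t w = \<sigma> t w * \<eta> t w"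
    using elim(1) by blast+
  let ?h = "ln ((\<sigma> t w)\<^sup>2)"
  have h: "?h = \<omega> + A_state (t - 1) w 0" using elim(2) by blast
  have ln_\<epsilon>: "ln ((\<epsilon> t w)\<^sup>2) = ?h + ln ((\<eta> t w)\<^sup>2)"
    using pos by (simp add: \<epsilon> power_mult_distrib ln_mult)
  have sign: "\<epsilon> t w > 0 \<longleftrightarrow> \<eta> t w > 0" "\<epsilon> t w < 0 \<longleftrightarrow> \<eta> t w < 0"
    using pos by (auto simp: \<epsilon> zero_less_mult_iff mult_less_0_iff)
  show ?case
  proof (intro allI impI)
    fix a assume a: "a < r"
    have step: "log_arch_term (Suc a) (\<epsilon> t w) (\<sigma> t w) =
        mu_coeff p q ap am \<beta> (Suc a) (\<eta> t w) * ?h + arch_coeff (Suc a) (\<eta> t w) * ln ((\<eta> t w)\<^sup>2)"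
      unfolding log_arch_term_def mu_coeff_def arch_coeff_def ln_\<epsilon> sign by (simp add: algebra_simps)
    \<comment> \<open>Beyond the last coordinate the defining sum is empty.\<close>
    have last: "(if Suc a < r then A_state (t - 1) w (Suc a) else 0) = A_state (t - 1) w (Suc a)"
      by (simp add: A_state_def)
    show "A_state t w a =
      (\<Sum>b<r. transpose_mat (companion (\<eta> t w)) $$ (a, b) * A_state (t - 1) w b) + A_noise (\<eta> t w) a"
      unfolding companion_transpose_sum[OF a] A_state_step[OF a] step last A_noise_def h
      by (simp add: algebra_simps)
  qed
qed

lemma arch_coeff_bounded: "\<bar>arch_coeff i x\<bar> \<le> \<bar>ap i\<bar> + \<bar>am i\<bar>"
  by (simp add: arch_coeff_def)

lemma mu_coeff_bounded: "\<bar>mu_coeff p q ap am \<beta> i x\<bar> \<le> \<bar>ap i\<bar> + \<bar>am i\<bar> + \<bar>\<beta> i\<bar>"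
  by (auto simp: mu_coeff_def)

lemma coeff_measurable [measurable]:
  "mu_coeff p q ap am \<beta> i \<in> borel_measurable borel" "arch_coeff i \<in> borel_measurable borel"
  unfolding mu_coeff_def[abs_def] arch_coeff_def[abs_def] by measurable

lemma A_noise_integrable: "integrable M (\<lambda>w. \<bar>A_noise (\<eta> 0 w) a\<bar> ^ m)"
  unfolding A_noise_def
proof (rule integrable_abs_power_add)
  have "integrable M (\<lambda>w. \<bar>mu_coeff p q ap am \<beta> (Suc a) (\<eta> 0 w)\<bar> ^ m)"
    by (rule integrable_const_bound[where B = "(\<bar>ap (Suc a)\<bar> + \<bar>am (Suc a)\<bar> + \<bar>\<beta> (Suc a)\<bar>) ^ m"])
      (auto intro!: power_mono mu_coeff_bounded)
  then show "integrable M (\<lambda>w. \<bar>\<omega> * mu_coeff p q ap am \<beta> (Suc a) (\<eta> 0 w)\<bar> ^ m)"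
    by (rule integrable_abs_power_mult)
  show "integrable M (\<lambda>w. \<bar>arch_coeff (Suc a) (\<eta> 0 w) * ln ((\<eta> 0 w)\<^sup>2)\<bar> ^ m)"
  proof (rule integrable_abs_power_le)
    show "integrable M (\<lambda>w. \<bar>(\<bar>ap (Suc a)\<bar> + \<bar>am (Suc a)\<bar>) * ln ((\<eta> 0 w)\<^sup>2)\<bar> ^ m)"
      by (rule integrable_abs_power_mult[OF ln_eta_moment])
    show "AE w in M. \<bar>arch_coeff (Suc a) (\<eta> 0 w) * ln ((\<eta> 0 w)\<^sup>2)\<bar> \<le>
        \<bar>(\<bar>ap (Suc a)\<bar> + \<bar>am (Suc a)\<bar>) * ln ((\<eta> 0 w)\<^sup>2)\<bar>"
      unfolding abs_mult using arch_coeff_bounded[of "Suc a"]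
      by (intro AE_I2 mult_right_mono) auto
  qed measurable
qed measurable

text \<open>For \<open>m = 1\<close> each mean involves one entry, hence one innovation, and only
  its law counts. For \<open>r = 1\<close> the matrix at time 1 has the single innovation at time 0.
  In other cases a Kronecker entry may multiply functions of different innovations.\<close>

lemma A_moment_eq_companion:
  assumes "m = 1 \<or> r = 1"
  shows "abs_kronecker_moment M r m (\<lambda>w. A_mat p q ap am \<beta> (\<lambda>s. \<eta> s w) 1) =
    abs_kronecker_moment M r m (\<lambda>w. companion (\<eta> 0 w))"
  using assms
proof
  assume "r = 1"
  then have "A_mat p q ap am \<beta> (\<lambda>s. \<eta> s w) 1 = companion (\<eta> 0 w)" for w
    unfolding A_mat_def companion_def by (intro eq_matI) auto
  then show ?thesis by simp
next
  assume m: "m = 1"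
  have single: "kronecker_power B 1 = B" for B :: "real mat"
    by (rule eq_matI) (auto simp: kronecker_def)
  have "expectation (\<lambda>w. \<bar>A_mat p q ap am \<beta> (\<lambda>s. \<eta> s w) 1 $$ (i, j)\<bar>) =
      expectation (\<lambda>w. \<bar>companion (\<eta> 0 w) $$ (i, j)\<bar>)" if ij: "i < r" "j < r" for i j
  proof (cases "i = 0")
    case True
    let ?f = "\<lambda>x. \<bar>mu_coeff p q ap am \<beta> (Suc j) x\<bar>" and ?u = "1 - int (Suc j)"
    have "integral\<^sup>L (distr M borel (\<eta> ?u)) ?f = integral\<^sup>L (distr M borel (\<eta> 0)) ?f"
      by (simp only: ident_eta[of ?u])
    then have "expectation (\<lambda>w. ?f (\<eta> ?u w)) = expectation (\<lambda>w. ?f (\<eta> 0 w))"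
      by (simp add: integral_distr)
    then show ?thesis using ij True by (simp add: A_mat_def companion_def)
  next
    case False
    then show ?thesis using ij by (simp add: A_mat_def companion_def)
  qed
  then show ?thesis
    unfolding abs_kronecker_moment_def m single
    by (intro eq_matI) (simp_all add: A_mat_def companion_def)
qed

text \<open>The recursion of \<open>A_state\<close> has the transposed companion matrix as
  coefficient. Its Kronecker moment is the transpose of that of \<open>companion\<close>, so the
  spectral condition on \<open>A_mat\<close> carries over.\<close>

lemma moments_from_A:
  assumes mr: "m = 1 \<or> r = 1" and contraction: "real_spectral_radius
    (abs_kronecker_moment M r m (\<lambda>w. A_mat p q ap am \<beta> (\<lambda>s. \<eta> s w) 1)) < 1"
  shows "integrable M (\<lambda>w. \<bar>ln ((\<sigma> t w)\<^sup>2)\<bar> ^ m)"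
proof -
  let ?F = "\<lambda>x. transpose_mat (companion x)"
  have carrier: "companion x \<in> carrier_mat r r" for x by (simp add: companion_def)
  interpret A: random_affine_recursion M \<eta> r m ?F A_noise A_state
  proof
    show "indep_vars (\<lambda>_. borel) \<eta> UNIV" by (rule indep_eta)
    show "distr M borel (\<eta> t) = distr M borel (\<eta> 0)" for t by (rule ident_eta)
    show "m > 0" by (rule m_pos)
    show "?F x \<in> carrier_mat r r" for x using carrier by simp
    show "(\<lambda>x. ?F x $$ (i, j)) \<in> borel_measurable borel" if "i < r" "j < r" for i j
      using that by (simp add: companion_def)
    have "\<bar>?F x $$ (i, j)\<bar> \<le> 1 + (\<Sum>i<r. \<bar>ap (Suc i)\<bar> + \<bar>am (Suc i)\<bar> + \<bar>\<beta> (Suc i)\<bar>)"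
      if "i < r" "j < r" for x i j
    proof -
      let ?B = "\<lambda>i. \<bar>ap (Suc i)\<bar> + \<bar>am (Suc i)\<bar> + \<bar>\<beta> (Suc i)\<bar>"
      have "\<bar>?F x $$ (i, j)\<bar> \<le> 1 + ?B i"
        using that mu_coeff_bounded[of "Suc i" x] by (simp add: companion_def)
      also have "?B i \<le> (\<Sum>i<r. ?B i)"
        using that by (intro member_le_sum) auto
      finally show ?thesis by simp
    qed
    then show "\<exists>K. \<forall>x i j. i < r \<longrightarrow> j < r \<longrightarrow> \<bar>?F x $$ (i, j)\<bar> \<le> K" by blast
    show "(\<lambda>x. A_noise x i) \<in> borel_measurable borel" for i
      unfolding A_noise_def by measurable
    show "integrable M (\<lambda>w. \<bar>A_noise (\<eta> 0 w) i\<bar> ^ m)" for i by (rule A_noise_integrable)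
    show "(\<lambda>w. A_state t w i) \<in> borel_measurable M" for t i by (rule A_state_measurable)
    show "AE w in M. \<forall>i<r. A_state t w i =
        (\<Sum>j<r. ?F (\<eta> t w) $$ (i, j) * A_state (t - 1) w j) + A_noise (\<eta> t w) i" for t
      by (rule A_recursion)
    show "\<exists>B. \<forall>t. prob {w \<in> space M. \<bar>A_state t w i\<bar> > B} \<le> \<delta>" if "0 < \<delta>" for i \<delta>
      using A_state_tight[of i] that unfolding tight_family_def by blast
    have E: "abs_kronecker_moment M r m (\<lambda>w. companion (\<eta> 0 w)) \<in> carrier_mat (r ^ m) (r ^ m)"
      by (simp add: abs_kronecker_moment_def)
    have "real_spectral_radius (abs_kronecker_moment M r m (\<lambda>w. ?F (\<eta> 0 w))) =
        real_spectral_radius (abs_kronecker_moment M r m (\<lambda>w. companion (\<eta> 0 w)))"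
      by (subst abs_kronecker_moment_transpose[OF carrier]) (rule real_spectral_radius_transpose[OF E])
    then show "real_spectral_radius (abs_kronecker_moment M r m (\<lambda>w. ?F (\<eta> 0 w))) < 1"
      using contraction unfolding A_moment_eq_companion[OF mr] by (rule ord_eq_less_trans)
  qed
  have state: "integrable M (\<lambda>w. \<bar>A_state (t - 1) w 0\<bar> ^ m)"
  \<comment> \<open>Without lags there is no coordinate 0 to which the recursion applies, but the
    state is then an empty sum.\<close>
  proof (cases "r = 0")
    case True
    have "A_state (t - 1) w 0 = 0" for w unfolding A_state_def True by simp
    then show ?thesis using m_pos by (simp add: power_0_left)
  next
    case False
    then have "0 < r" by (simp only: neq0_conv)
    then show ?thesis by (rule A.integrable_moment)
  qed
  show ?thesis
  proof (rule integrable_abs_power_le)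
    show "integrable M (\<lambda>w. \<bar>\<omega> + A_state (t - 1) w 0\<bar> ^ m)"
      using state A_state_measurable by (intro integrable_abs_power_add) auto
    show "AE w in M. \<bar>ln ((\<sigma> t w)\<^sup>2)\<bar> \<le> \<bar>\<omega> + A_state (t - 1) w 0\<bar>"
      using ln_volatility_A by eventually_elim simp
  qed simp
qed

end

section \<open>Log-moments of the solution from either spectral condition\<close>

theorem proposition2p2:
  fixes M :: "'s measure"
    and p q m :: nat
    and \<omega> :: real
    and ap am \<beta> :: "nat \<Rightarrow> real"
    and \<eta> \<epsilon> \<sigma> :: "int \<Rightarrow> 's \<Rightarrow> real"
  assumes "prob_space M"
    and "log_garch_innovations M \<eta>"
    and "m > 0"
    and "top_lyapunov M (2 * q + p) (\<lambda>t w. C_mat p q ap am \<beta> (\<eta> t w)) < 0"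
    and "abs_log_moment M m (\<lambda>w. (\<eta> 0 w)\<^sup>2) < \<infinity>"
    and "log_garch_solution M p q \<omega> ap am \<beta> \<eta> \<epsilon> \<sigma>"
    and "strictly_stationary M (\<lambda>t w. (\<epsilon> t w, \<sigma> t w))"
  shows "((m = 1 \<or> max p q = 1) \<longrightarrow>
           real_spectral_radius
             (abs_kronecker_moment M (max p q) m (\<lambda>w. A_mat p q ap am \<beta> (\<lambda>s. \<eta> s w) 1)) < 1 \<longrightarrow>
           (\<forall>t. abs_log_moment M m (\<lambda>w. (\<epsilon> t w)\<^sup>2) < \<infinity> \<and>
                abs_log_moment M m (\<lambda>w. (\<sigma> t w)\<^sup>2) < \<infinity>)) \<and>
         (real_spectral_radius
             (abs_kronecker_moment M (2 * q + p) m (\<lambda>w. C_mat p q ap am \<beta> (\<eta> 1 w))) < 1 \<longrightarrow>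
           (\<forall>t. abs_log_moment M m (\<lambda>w. (\<epsilon> t w)\<^sup>2) < \<infinity> \<and>
                abs_log_moment M m (\<lambda>w. (\<sigma> t w)\<^sup>2) < \<infinity>))"
proof -
  interpret prob_space M by fact
  interpret stationary_log_garch M p q m \<omega> ap am \<beta> \<eta> \<epsilon> \<sigma>
    by unfold_locales fact+
  show ?thesis
    using moments_from_A moments_from_C log_moments_finite by blast
qed

end
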